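(* In the setting described in the context, for every $v\in V$, almost surely $R^v_m$ converges uniformly on $[0,1]$ (i.e. in $\|\cdot\|_\infty$) as $m\to\infty$ to a random element $R^v$ of $D$ with $E\|R^v\|_\infty^2<\infty$. The family $(R^v)_{v\in V}$ satisfies, for every $v\in V$, almost surely $$R^v=T^v_1(R^{v1})+T^v_2(R^{v2})+C^v .$$ Moreover, for every $p>1$, every $v\in V$ and every $m\in\mathbb N_0$, $$\big\|\,\|R^v_m\|_\infty\big\|_{L_p}\le\frac{8+2^{-1/p}k_p\,\|Q^\emptyset\|_{L_p}}{1-k_p},\qquad k_p=\Big(\frac{2}{p+1}\Big)^{1/p}.$$
   Context: Notation. $V=\bigcup_{k\ge0}\{1,2\}^k$ is the rooted binary tree of finite words over $\{1,2\}$; $\emptyset$ is the empty word (root), $vw$ is concatenation, $|v|$ is the length, $V_m$ (resp. $V_{<m}$) is the set of words of length $m$ (resp. $<m$). $D=D[0,1]$ is the space of càdlàg functions $[0,1]\to\mathbb R$, $\|f\|_\infty=\sup_t|f(t)|$; $\|X\|_{L_p}=(E|X|^p)^{1/p}$. $(U^v)_{v\in V}$ are i.i.d. random variables uniformly distributed on $[0,1]$. Cost functions: $C(x)=1+2x\ln x+2(1-x)\ln(1-x)$ for $x\in[0,1]$ (with $0\ln0=0$), and for $t,x\in[0,1]$, $C(t,x)=C(x)+2\,\mathbf 1_{t<x}\big(-1+x+(1-t)\ln(1-t)-(1-x)\ln(1-x)-(x-t)\ln(x-t)\big)$. Quicksort limit variables: for $v,w\in V$ put $\ell^v_\emptyset=1$,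 $\ell^v_{w1}=\ell^v_wU^{vw}$, $\ell^v_{w2}=\ell^v_w(1-U^{vw})$ and $Q^v=\lim_{m\to\infty}\sum_{w\in V_{<m}}\ell^v_wC(U^{vw})$; this limit exists a.s. and in $L_2$, $Q^v$ has the mean-zero Quicksort limit distribution (which has finite moments of all orders), and $Q^v=U^vQ^{v1}+(1-U^v)Q^{v2}+C(U^v)$ a.s. Weighted branching structure: for $v\in V$ define random linear maps $T^v_1,T^v_2$ on functions $h:[0,1]\to\mathbb R$ by $(T^v_1h)(t)=\mathbf 1_{t<U^v}\,U^v\,h(1\wedge t/U^v)$ and $(T^v_2h)(t)=\mathbf 1_{t\ge U^v}(1-U^v)\,h\big(0\vee\frac{t-U^v}{1-U^v}\big)$; the random function $C^v(t)=C(t,U^v)+\mathbf 1_{t\ge U^v}U^vQ^{v1}$; path operators $L^v_\emptyset=\mathrm{id}$, $L^v_{wi}=L^v_w\circ T^{vw}_i$ ($i=1,2$); and $R^v_m=\sum_{w\in V_{<m}}L^v_w(C^{vw})$ for $m\in\mathbb N_0$ (so $R^v_0=0$). *)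

theory Defs
  imports "HOL-Probability.Probability"
begin

definition Vset :: "nat list set" where
  "Vset = {w. set w \<subseteq> {1,2}}"

definition Vlt :: "nat \<Rightarrow> nat list set" where
  "Vlt m = {w \<in> Vset. length w < m}"

definition xlnx :: "real \<Rightarrow> real" where
  "xlnx y = (if y = 0 then 0 else y * ln y)"

definition Ccost :: "real \<Rightarrow> real" where
  "Ccost x = 1 + 2 * xlnx x + 2 * xlnx (1 - x)"

definition Ccost2 :: "real \<Rightarrow> real \<Rightarrow> real" where
  "Ccost2 t x = Ccost x + 2 * (if t < x then
       -1 + x + xlnx (1 - t) - xlnx (1 - x) - xlnx (x - t) else 0)"

text \<open>ell_rev U v rw is the weight for the word rev rw (recursion on the last letter).\<close>
primrec ell_rev :: "(nat list \<Rightarrow> 'a \<Rightarrow> real) \<Rightarrow> nat list \<Rightarrow> nat list \<Rightarrow> 'a \<Rightarrow> real" where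
  "ell_rev U v [] \<omega> = 1"
| "ell_rev U v (i # rw) \<omega> = ell_rev U v rw \<omega> *
     (if i = 1 then U (v @ rev rw) \<omega> else 1 - U (v @ rev rw) \<omega>)"

definition ell :: "(nat list \<Rightarrow> 'a \<Rightarrow> real) \<Rightarrow> nat list \<Rightarrow> nat list \<Rightarrow> 'a \<Rightarrow> real" where
  "ell U v w \<omega> = ell_rev U v (rev w) \<omega>"

definition Qlim :: "(nat list \<Rightarrow> 'a \<Rightarrow> real) \<Rightarrow> nat list \<Rightarrow> 'a \<Rightarrow> real" where
  "Qlim U v \<omega> = lim (\<lambda>m. \<Sum>w\<in>Vlt m. ell U v w \<omega> * Ccost (U (v @ w) \<omega>))"

definition T1 :: "real \<Rightarrow> (real \<Rightarrow> real) \<Rightarrow> real \<Rightarrow> real" where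
  "T1 u h t = (if t < u then u * h (min 1 (t / u)) else 0)"

definition T2 :: "real \<Rightarrow> (real \<Rightarrow> real) \<Rightarrow> real \<Rightarrow> real" where
  "T2 u h t = (if u \<le> t then (1 - u) * h (max 0 ((t - u) / (1 - u))) else 0)"

definition Tmap :: "real \<Rightarrow> nat \<Rightarrow> (real \<Rightarrow> real) \<Rightarrow> real \<Rightarrow> real" where
  "Tmap u i = (if i = 1 then T1 u else T2 u)"

definition Cfun :: "(nat list \<Rightarrow> 'a \<Rightarrow> real) \<Rightarrow> nat list \<Rightarrow> 'a \<Rightarrow> real \<Rightarrow> real" where
  "Cfun U v \<omega> t = Ccost2 t (U v \<omega>) +
     (if U v \<omega> \<le> t then U v \<omega> * Qlim U (v @ [1]) \<omega> else 0)"

text \<open>Lrev U v rw is the path operator for the word rev rw: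
  L_empty = id, L_(w i) = L_w o T^(v w)_i.\<close>
primrec Lrev :: "(nat list \<Rightarrow> 'a \<Rightarrow> real) \<Rightarrow> nat list \<Rightarrow> nat list \<Rightarrow> 'a
                 \<Rightarrow> (real \<Rightarrow> real) \<Rightarrow> real \<Rightarrow> real" where
  "Lrev U v [] \<omega> = id"
| "Lrev U v (i # rw) \<omega> = Lrev U v rw \<omega> \<circ> Tmap (U (v @ rev rw) \<omega>) i"

definition Lpath :: "(nat list \<Rightarrow> 'a \<Rightarrow> real) \<Rightarrow> nat list \<Rightarrow> nat list \<Rightarrow> 'a
                 \<Rightarrow> (real \<Rightarrow> real) \<Rightarrow> real \<Rightarrow> real" where
  "Lpath U v w \<omega> = Lrev U v (rev w) \<omega>"

definition Rm :: "(nat list \<Rightarrow> 'a \<Rightarrow> real) \<Rightarrow> nat list \<Rightarrow> nat \<Rightarrow> 'a \<Rightarrow> real \<Rightarrow> real" where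
  "Rm U v m \<omega> t = (\<Sum>w\<in>Vlt m. Lpath U v w \<omega> (Cfun U (v @ w) \<omega>) t)"

definition cadlag01 :: "(real \<Rightarrow> real) \<Rightarrow> bool" where
  "cadlag01 f \<longleftrightarrow> (\<forall>t\<in>{0..<1}. continuous (at_right t) f) \<and>
                   (\<forall>t\<in>{0<..1}. \<exists>l. (f \<longlongrightarrow> l) (at_left t))"

definition supnorm :: "(real \<Rightarrow> real) \<Rightarrow> real" where
  "supnorm f = (SUP t\<in>{0..1}. \<bar>f t\<bar>)"

definition kp :: "real \<Rightarrow> real" where
  "kp p = (2 / (p + 1)) powr (1 / p)"

end

theory Submission
  imports Defs "HOL-Real_Asymp.Real_Asymp"
begin

text \<open>
  The shifted families \<open>(U (v @ w))\<^sub>w\<close> all have the law of an i.i.d. uniform family on a canonical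
  product space, under which the root variable and the two subtrees are independent and the subtrees
  are again canonical.  So every estimate is an induction over the decomposition at the root.

  The operators \<open>T\<^sub>1\<close> and \<open>T\<^sub>2\<close> act on disjoint parts of the interval, so the norm of
  \<open>T\<^sub>1 h\<^sub>1 + T\<^sub>2 h\<^sub>2\<close> is the maximum of the two norms, and
  \<open>max a b powr p \<le> a powr p + b powr p\<close> gives an \<open>L\<^sub>p\<close> contraction with factor
  \<open>(2 / (p + 1)) powr (1 / p)\<close>.  Minkowski's inequality and the bound \<open>8 + u * \<bar>Q\<bar>\<close> for the toll function
  make the asserted constant invariant under the recursion.  For \<open>p = 2\<close> the same contraction makes
  the increments of \<open>R\<^sub>m\<close> geometrically small, hence almost surely summable in the supremum norm.

  All moments of \<open>Q\<close> are finite because the moment generating functions of its approximations stay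
  below \<open>exp (12 l\<^sup>2)\<close> near zero; \<open>Q\<close> itself exists since the centred increments
  contract in \<open>L\<^sub>2\<close> with factor \<open>2/3\<close>.
\<close>

text \<open>The toll \<open>Cfun\<close> contains the full limit \<open>Qlim\<close> of the left
  subtree, not a truncation of it. The root toll therefore cancels in the increments of
  \<open>Rm\<close>, which obey a homogeneous recursion, but the moments of Q have to be settled
  first: a Bochner integral of a non-integrable function is 0, so the asserted bound means what it
  should only once the p-th power of Q is known to be integrable. The toll also depends on the left
  branch that it is added to; Minkowski's inequality sees only norms and does not mind. The constant
  solves A = k_p A + 8 + s, where s is the L_p norm of u Q, with u uniform and independent of Q:
  indeed 2^(-1/p) k_p = (1/(p+1))^(1/p) is the L_p norm of u. The second obstacle is measurability:
  \<open>supnorm\<close> is an uncountable supremum and M need not be complete, so the cadlag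
  property is proved at every sample point and not merely almost surely.\<close>

lemma Nil_in_Vset [simp]: "[] \<in> Vset"
  by (simp add: Vset_def)

lemma Vset_nonempty [simp]: "Vset \<noteq> {}"
  using Nil_in_Vset by blast

lemma Cons_in_Vset [simp]: "i # w \<in> Vset \<longleftrightarrow> (i = 1 \<or> i = 2) \<and> w \<in> Vset"
  by (auto simp: Vset_def)

lemma append_in_Vset [simp]: "v @ w \<in> Vset \<longleftrightarrow> v \<in> Vset \<and> w \<in> Vset"
  by (auto simp: Vset_def)

lemma countable_Vset: "countable Vset"
  by (rule countableI_type)

lemma Vlt_0 [simp]: "Vlt 0 = {}"
  by (simp add: Vlt_def)

lemma Vlt_Suc: "Vlt (Suc m) = insert [] ((#) 1 ` Vlt m \<union> (#) 2 ` Vlt m)"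
proof (intro set_eqI)
  fix w show "w \<in> Vlt (Suc m) \<longleftrightarrow> w \<in> insert [] ((#) 1 ` Vlt m \<union> (#) 2 ` Vlt m)"
    by (cases w) (auto simp: Vlt_def)
qed

lemma finite_Vlt [simp]: "finite (Vlt m)"
  by (induction m) (auto simp: Vlt_Suc)

lemma sum_Vlt_Suc:
  "(\<Sum>w\<in>Vlt (Suc m). f w) = f [] + (\<Sum>w\<in>Vlt m. f (1 # w)) + (\<Sum>w\<in>Vlt m. f (2 # w))"
  for f :: "nat list \<Rightarrow> real"
proof -
  have "(\<Sum>w\<in>Vlt (Suc m). f w) = f [] + (\<Sum>w\<in>(#) 1 ` Vlt m \<union> (#) 2 ` Vlt m. f w)"
    unfolding Vlt_Suc by (subst sum.insert) auto
  also have "(\<Sum>w\<in>(#) 1 ` Vlt m \<union> (#) 2 ` Vlt m. f w)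
     = (\<Sum>w\<in>(#) 1 ` Vlt m. f w) + (\<Sum>w\<in>(#) 2 ` Vlt m. f w)"
    by (rule sum.union_disjoint) auto
  also have "(\<Sum>w\<in>(#) 1 ` Vlt m. f w) = (\<Sum>w\<in>Vlt m. f (1 # w))"
    by (subst sum.reindex) auto
  also have "(\<Sum>w\<in>(#) 2 ` Vlt m. f w) = (\<Sum>w\<in>Vlt m. f (2 # w))"
    by (subst sum.reindex) auto
  finally show ?thesis by simp
qed

subsection \<open>Recursion at the root\<close>

definition Qm :: "(nat list \<Rightarrow> 'a \<Rightarrow> real) \<Rightarrow> nat list \<Rightarrow> nat \<Rightarrow> 'a \<Rightarrow> real" where
  "Qm U v m \<omega> = (\<Sum>w\<in>Vlt m. ell U v w \<omega> * Ccost (U (v @ w) \<omega>))"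

text \<open>The definitions recurse on the last letter, the proof on the first. Appending to the
  reversed word prepends a letter to the path, which turns the former recursion into the latter.
  \<open>Lrev_snoc\<close> does the same for operators, where the root operator ends up
  outermost.\<close>

lemma ell_rev_snoc:
  "ell_rev U v (rw @ [i]) \<omega> = (if i = 1 then U v \<omega> else 1 - U v \<omega>) * ell_rev U (v @ [i]) rw \<omega>"
  by (induction rw) auto

lemma ell_Nil [simp]: "ell U v [] \<omega> = 1"
  by (simp add: ell_def)

lemma ell_Cons: "ell U v (i # w) \<omega> = (if i = 1 then U v \<omega> else 1 - U v \<omega>) * ell U (v @ [i]) w \<omega>"
  by (simp add: ell_def ell_rev_snoc)

lemma Qm_0 [simp]: "Qm U v 0 \<omega> = 0"
  by (simp add: Qm_def)

lemma Qm_Suc: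
  "Qm U v (Suc m) \<omega> = Ccost (U v \<omega>) + U v \<omega> * Qm U (v @ [1]) m \<omega> + (1 - U v \<omega>) * Qm U (v @ [2]) m \<omega>"
  unfolding Qm_def sum_Vlt_Suc by (simp add: ell_Cons sum_distrib_left mult.assoc)

lemma Lrev_snoc: "Lrev U v (rw @ [i]) \<omega> = Tmap (U v \<omega>) i \<circ> Lrev U (v @ [i]) rw \<omega>"
  by (induction rw) (auto simp: o_assoc)

lemma Lpath_Nil [simp]: "Lpath U v [] \<omega> = id"
  by (simp add: Lpath_def)

lemma Lpath_Cons: "Lpath U v (i # w) \<omega> = Tmap (U v \<omega>) i \<circ> Lpath U (v @ [i]) w \<omega>"
  by (simp add: Lpath_def Lrev_snoc)

lemma T1_sum: "T1 u (\<lambda>t. \<Sum>w\<in>A. f w t) t = (\<Sum>w\<in>A. T1 u (f w) t)"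
  by (simp add: T1_def sum_distrib_left)

lemma T2_sum: "T2 u (\<lambda>t. \<Sum>w\<in>A. f w t) t = (\<Sum>w\<in>A. T2 u (f w) t)"
  by (simp add: T2_def sum_distrib_left)

lemma Rm_0 [simp]: "Rm U v 0 \<omega> t = 0"
  by (simp add: Rm_def)

lemma Rm_Suc:
  "Rm U v (Suc m) \<omega> t = T1 (U v \<omega>) (Rm U (v @ [1]) m \<omega>) t + T2 (U v \<omega>) (Rm U (v @ [2]) m \<omega>) t
     + Cfun U v \<omega> t"
  unfolding Rm_def[abs_def] sum_Vlt_Suc T1_sum T2_sum
  by (simp add: Lpath_Cons Tmap_def)

subsection \<open>Shift invariance\<close>

text \<open>The restriction makes the result extensional, hence a point of the product space over
  \<open>Vset\<close>.\<close>

definition Vshift :: "nat list \<Rightarrow> (nat list \<Rightarrow> real) \<Rightarrow> nat list \<Rightarrow> real" where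
  "Vshift v x = (\<lambda>w\<in>Vset. x (v @ w))"

text \<open>The evaluation maps play the part of the family \<open>U\<close> on the canonical space,
  where a sample point is itself the whole labelled tree.\<close>

abbreviation (input) coord :: "nat list \<Rightarrow> (nat list \<Rightarrow> real) \<Rightarrow> real" where
  "coord w x \<equiv> x w"

context
  fixes U :: "nat list \<Rightarrow> 'a \<Rightarrow> real" and U' :: "nat list \<Rightarrow> 'b \<Rightarrow> real" and \<omega> :: 'a and \<omega>' :: 'b
begin

text \<open>The two families may live on different spaces and start at different vertices: only the
  labels read along the subtree matter. This is the bridge between M and the canonical
  space.\<close>

lemma Qm_cong:
  assumes "\<And>w. w \<in> Vset \<Longrightarrow> U (v @ w) \<omega> = U' (v' @ w) \<omega>'"
  shows "Qm U v m \<omega> = Qm U' v' m \<omega>'"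
  using assms
proof (induction m arbitrary: v v')
  case (Suc m)
  have "Qm U (v @ [i]) m \<omega> = Qm U' (v' @ [i]) m \<omega>'" if "i = 1 \<or> i = 2" for i
    by (intro Suc.IH) (use that Suc.prems[of "i # w" for w] in auto)
  then show ?case
    using Suc.prems[of "[]"] by (simp add: Qm_Suc)
qed simp

lemma Qlim_cong:
  assumes "\<And>w. w \<in> Vset \<Longrightarrow> U (v @ w) \<omega> = U' (v' @ w) \<omega>'"
  shows "Qlim U v \<omega> = Qlim U' v' \<omega>'"
  using Qm_cong[OF assms] by (simp add: Qlim_def Qm_def[symmetric])

lemma Cfun_cong:
  assumes "\<And>w. w \<in> Vset \<Longrightarrow> U (v @ w) \<omega> = U' (v' @ w) \<omega>'"
  shows "Cfun U v \<omega> = Cfun U' v' \<omega>'"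
proof -
  have "Qlim U (v @ [1]) \<omega> = Qlim U' (v' @ [1]) \<omega>'"
    using assms[of "1 # w" for w] by (intro Qlim_cong) auto
  then show ?thesis
    using assms[of "[]"] by (auto simp: Cfun_def fun_eq_iff)
qed

lemma Rm_cong:
  assumes "\<And>w. w \<in> Vset \<Longrightarrow> U (v @ w) \<omega> = U' (v' @ w) \<omega>'"
  shows "Rm U v m \<omega> = Rm U' v' m \<omega>'"
  using assms
proof (induction m arbitrary: v v')
  case 0 then show ?case by (simp add: fun_eq_iff)
next
  case (Suc m)
  have "Rm U (v @ [i]) m \<omega> = Rm U' (v' @ [i]) m \<omega>'" if "i = 1 \<or> i = 2" for i
    by (intro Suc.IH) (use that Suc.prems[of "i # w" for w] in auto)
  then show ?case
    using Suc.prems[of "[]"] Cfun_cong[OF Suc.prems] by (intro ext) (simp add: Rm_Suc)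
qed

end

lemma
  shows Qm_Vshift: "Qm U v m \<omega> = Qm coord [] m (Vshift v (\<lambda>w. U w \<omega>))"
    and Qlim_Vshift: "Qlim U v \<omega> = Qlim coord [] (Vshift v (\<lambda>w. U w \<omega>))"
    and Rm_Vshift: "Rm U v m \<omega> = Rm coord [] m (Vshift v (\<lambda>w. U w \<omega>))"
  by (intro Qm_cong Qlim_cong Rm_cong; simp add: Vshift_def)+

subsection \<open>The cost functions\<close>

lemma xlnx_0 [simp]: "xlnx 0 = 0" and xlnx_1 [simp]: "xlnx 1 = 0"
  by (simp_all add: xlnx_def)

lemma xlnx_measurable [measurable]: "xlnx \<in> borel_measurable borel"
  unfolding xlnx_def[abs_def] by measurable

lemma Ccost_measurable [measurable]: "Ccost \<in> borel_measurable borel"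
  unfolding Ccost_def[abs_def] by measurable

lemma Ccost2_measurable [measurable]:
  "(\<lambda>z. Ccost2 (fst z) (snd z)) \<in> borel_measurable (borel \<Otimes>\<^sub>M borel)"
  unfolding Ccost2_def by measurable

lemma xlnx_nonpos: "0 \<le> x \<Longrightarrow> x \<le> 1 \<Longrightarrow> xlnx x \<le> 0"
  by (auto simp: xlnx_def mult_nonneg_nonpos)

text \<open>The true minimum is -1/e. The rounder value follows from ln z <= z - 1 at z = 1/(2x)
  together with ln 2 <= 1, and it is just enough for the bound 1 on \<open>Ccost\<close>.\<close>

lemma xlnx_lower: "0 \<le> x \<Longrightarrow> - 1 / 2 \<le> xlnx x"
proof -
  assume x: "0 \<le> x"
  show ?thesis
  proof (cases "x = 0")
    case False
    with x have x: "x > 0" by simp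
    have "ln (inverse x / 2) \<le> inverse x / 2 - 1"
      using x by (intro ln_le_minus_one) simp
    moreover have "ln (inverse x / 2) = - ln x - ln 2"
      using x by (simp add: ln_div ln_inverse)
    moreover have "ln 2 \<le> (1::real)"
      using ln_le_minus_one[of "2::real"] by simp
    ultimately have "- ln x \<le> inverse x / 2" by simp
    then have "x * (- ln x) \<le> x * (inverse x / 2)"
      using x by (intro mult_left_mono) auto
    then show ?thesis using x by (simp add: xlnx_def)
  qed simp
qed

lemma abs_Ccost_le: "0 \<le> x \<Longrightarrow> x \<le> 1 \<Longrightarrow> \<bar>Ccost x\<bar> \<le> 1"
  using xlnx_nonpos[of x] xlnx_nonpos[of "1 - x"] xlnx_lower[of x] xlnx_lower[of "1 - x"]
  by (auto simp: Ccost_def)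

text \<open>Each \<open>xlnx\<close> term lies in [-1/2, 0], so the bracket lies in [-3/2, 1] and
  the total is at most 4 in absolute value; 8 is the constant that the theorem asks for.\<close>

lemma abs_Ccost2_le:
  assumes "0 \<le> x" "x \<le> 1" "0 \<le> t" "t \<le> 1"
  shows "\<bar>Ccost2 t x\<bar> \<le> 8"
proof (cases "t < x")
  case True
  then show ?thesis
    using assms abs_Ccost_le[of x] xlnx_nonpos[of "1 - t"] xlnx_lower[of "1 - t"]
      xlnx_nonpos[of "1 - x"] xlnx_lower[of "1 - x"] xlnx_nonpos[of "x - t"] xlnx_lower[of "x - t"]
    by (auto simp: Ccost2_def)
next
  case False
  then show ?thesis using assms abs_Ccost_le[of x] by (auto simp: Ccost2_def)
qed

lemma isCont_xlnx: "x > 0 \<Longrightarrow> isCont xlnx x"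
proof -
  assume x: "x > 0"
  have "isCont (\<lambda>y. y * ln y) x"
    using x by (intro continuous_intros) auto
  moreover have "eventually (\<lambda>y. y * ln y = xlnx y) (nhds x)"
    using eventually_nhds_in_open[of "{0<..}" x] x
    by (auto elim!: eventually_mono simp: xlnx_def)
  ultimately show ?thesis using isCont_cong[of "\<lambda>y. y * ln y" xlnx x] by simp
qed

lemma tendsto_xlnx_0: "(xlnx \<longlongrightarrow> 0) (at_right 0)"
proof -
  have "((\<lambda>y::real. y * ln y) \<longlongrightarrow> 0) (at_right 0)"
    by real_asymp
  moreover have "eventually (\<lambda>y. y * ln y = xlnx y) (at_right (0::real))"
    by (auto simp: eventually_at_filter xlnx_def)
  ultimately show ?thesis by (rule Lim_transform_eventually)
qed

lemma continuous_on_xlnx: "continuous_on {0..} xlnx"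
proof -
  have "(xlnx \<longlongrightarrow> xlnx x) (at x within {0..})" if "x \<ge> 0" for x
  proof (cases "x = 0")
    case True
    then show ?thesis using tendsto_xlnx_0 
      by (simp add: at_within_Ici_at_right)
  next
    case False
    then show ?thesis using isCont_xlnx[of x] that
      by (auto simp: continuous_at intro: tendsto_within_subset)
  qed
  then show ?thesis by (auto simp: continuous_on_def)
qed

subsection \<open>Bounded cadlag functions\<close>

text \<open>Boundedness is carried along explicitly because it makes \<open>supnorm\<close> a
  genuine supremum: \<open>SUP\<close> over an unbounded set of reals has no useful value.\<close>

definition bcadlag :: "(real \<Rightarrow> real) \<Rightarrow> bool" where
  "bcadlag f \<longleftrightarrow> cadlag01 f \<and> bounded (f ` {0..1})"

lemma cadlag01_right: "cadlag01 f \<Longrightarrow> 0 \<le> t \<Longrightarrow> t < 1 \<Longrightarrow> (f \<longlongrightarrow> f t) (at_right t)"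
  by (auto simp: cadlag01_def continuous_within)

lemma cadlag01_left:
  assumes "cadlag01 f" "0 < t" "t \<le> 1"
  obtains l where "(f \<longlongrightarrow> l) (at_left t)"
  using assms by (auto simp: cadlag01_def dest!: bspec[of _ _ t])

lemma cadlag01I:
  assumes "\<And>t. 0 \<le> t \<Longrightarrow> t < 1 \<Longrightarrow> (f \<longlongrightarrow> f t) (at_right t)"
    and "\<And>t. 0 < t \<Longrightarrow> t \<le> 1 \<Longrightarrow> \<exists>l. (f \<longlongrightarrow> l) (at_left t)"
  shows "cadlag01 f"
  using assms by (auto simp: cadlag01_def continuous_within)

lemma cadlag01_add: "cadlag01 f \<Longrightarrow> cadlag01 g \<Longrightarrow> cadlag01 (\<lambda>t. f t + g t)"
  by (rule cadlag01I) (blast intro: tendsto_add cadlag01_right elim: cadlag01_left)+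

lemma cadlag01_diff: "cadlag01 f \<Longrightarrow> cadlag01 g \<Longrightarrow> cadlag01 (\<lambda>t. f t - g t)"
  by (rule cadlag01I) (blast intro: tendsto_diff cadlag01_right elim: cadlag01_left)+

lemma bcadlag_add: "bcadlag f \<Longrightarrow> bcadlag g \<Longrightarrow> bcadlag (\<lambda>t. f t + g t)"
  by (auto simp: bcadlag_def cadlag01_add bounded_plus_comp)

lemma bcadlag_diff: "bcadlag f \<Longrightarrow> bcadlag g \<Longrightarrow> bcadlag (\<lambda>t. f t - g t)"
  by (auto simp: bcadlag_def cadlag01_diff bounded_minus_comp)

lemma bcadlag_zero [simp]: "bcadlag (\<lambda>t. 0)"
  by (auto simp: bcadlag_def cadlag01_def bounded_iff intro: tendsto_const)

lemma bcadlagI: "cadlag01 f \<Longrightarrow> (\<And>t. t \<in> {0..1} \<Longrightarrow> \<bar>f t\<bar> \<le> B) \<Longrightarrow> bcadlag f"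
  unfolding bcadlag_def bounded_iff by (auto intro!: exI[of _ B])

lemma bcadlag_bound: "bcadlag f \<Longrightarrow> \<exists>B. \<forall>t\<in>{0..1}. \<bar>f t\<bar> \<le> B"
  by (auto simp: bcadlag_def bounded_iff)

section \<open>One-sided limits under the branch operators\<close>

lemma filterlim_affine_at_right:
  assumes "(c::real) > 0"
  shows "filterlim (\<lambda>s. (s - u) / c) (at_right ((t - u) / c)) (at_right t)"
proof -
  have "((\<lambda>s. (s - u) / c) \<longlongrightarrow> (t - u) / c) (at_right t)"
    using assms by (intro tendsto_intros) auto
  moreover have "eventually (\<lambda>s. (s - u) / c > (t - u) / c) (at_right t)"
    using assms by (auto simp: eventually_at_filter divide_strict_right_mono)
  ultimately show ?thesis
    by (auto simp: filterlim_at elim!: eventually_mono)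
qed

lemma filterlim_affine_at_left:
  assumes "(c::real) > 0"
  shows "filterlim (\<lambda>s. (s - u) / c) (at_left ((t - u) / c)) (at_left t)"
proof -
  have "((\<lambda>s. (s - u) / c) \<longlongrightarrow> (t - u) / c) (at_left t)"
    using assms by (intro tendsto_intros) auto
  moreover have "eventually (\<lambda>s. (s - u) / c < (t - u) / c) (at_left t)"
    using assms by (auto simp: eventually_at_filter divide_strict_right_mono)
  ultimately show ?thesis
    by (auto simp: filterlim_at elim!: eventually_mono)
qed

lemma eventually_at_right_less: "(t::real) < b \<Longrightarrow> eventually (\<lambda>s. s < b) (at_right t)"
  and eventually_at_right_greater: "(a::real) \<le> t \<Longrightarrow> eventually (\<lambda>s. a < s) (at_right t)"
  and eventually_at_left_greater: "(a::real) < t \<Longrightarrow> eventually (\<lambda>s. a < s) (at_left t)"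
  and eventually_at_left_less: "(t::real) \<le> b \<Longrightarrow> eventually (\<lambda>s. s < b) (at_left t)"
  unfolding eventually_at_right_field eventually_at_left_field
  by (force intro: exI[of _ b] exI[of _ "t + 1"] exI[of _ a] exI[of _ "t - 1"])+

text \<open>Away from u this is an affine change of time, with \<open>min\<close> inactive. At t = u
  the value and the right limit are 0, while the left limit is inherited from the left limit of h at
  1. For \<open>T2\<close> the roles are exchanged: right continuity at u comes from that of h at 0,
  and the left limit is 0.\<close>

lemma cadlag01_T1:
  assumes "cadlag01 h"
  shows "cadlag01 (T1 u h)"
proof (rule cadlag01I)
  fix t :: real assume t: "0 \<le> t" "t < 1"
  show "(T1 u h \<longlongrightarrow> T1 u h t) (at_right t)"
  proof (cases "t < u")
    case True
    then have u: "u > 0" using t by simp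
    have tu: "0 \<le> t / u" "t / u < 1" using t u True by auto
    have "((\<lambda>s. h ((s - 0) / u)) \<longlongrightarrow> h (t / u)) (at_right t)"
      using filterlim_compose[OF cadlag01_right[OF assms tu] filterlim_affine_at_right[OF u, of 0 t, simplified]]
      by simp
    then have "((\<lambda>s. u * h (s / u)) \<longlongrightarrow> u * h (t / u)) (at_right t)"
      by (auto intro: tendsto_intros)
    moreover have "eventually (\<lambda>s. u * h (s / u) = T1 u h s) (at_right t)"
      using eventually_at_right_less[OF True] by eventually_elim (use u in \<open>auto simp: T1_def min_def\<close>)
    ultimately show ?thesis
      using True tu by (auto simp: T1_def min_def intro: Lim_transform_eventually)
  next
    case False
    then have "eventually (\<lambda>s. 0 = T1 u h s) (at_right t)"
      using eventually_at_right_greater[of t t] by (auto simp: T1_def elim!: eventually_mono)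
    then have "(T1 u h \<longlongrightarrow> 0) (at_right t)"
      by (rule Lim_transform_eventually[OF tendsto_const])
    then show ?thesis using False by (simp add: T1_def)
  qed
next
  fix t :: real assume t: "0 < t" "t \<le> 1"
  show "\<exists>l. (T1 u h \<longlongrightarrow> l) (at_left t)"
  proof (cases "t \<le> u")
    case True
    then have u: "u > 0" using t by simp
    have tu: "0 < t / u" "t / u \<le> 1" using t u True by auto
    obtain l where l: "(h \<longlongrightarrow> l) (at_left (t / u))"
      using cadlag01_left[OF assms tu] .
    have "((\<lambda>s. h ((s - 0) / u)) \<longlongrightarrow> l) (at_left t)"
      using filterlim_compose[OF l filterlim_affine_at_left[OF u, of 0 t, simplified]]
      by simp
    then have "((\<lambda>s. u * h (s / u)) \<longlongrightarrow> u * l) (at_left t)"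
      by (auto intro: tendsto_intros)
    moreover have "eventually (\<lambda>s. u * h (s / u) = T1 u h s) (at_left t)"
      using eventually_at_left_less[OF True] by eventually_elim (use u in \<open>auto simp: T1_def min_def\<close>)
    ultimately show ?thesis
      by (auto intro: Lim_transform_eventually)
  next
    case False
    then have "eventually (\<lambda>s. 0 = T1 u h s) (at_left t)"
      using eventually_at_left_greater[of u t] by (auto simp: T1_def elim!: eventually_mono)
    then show ?thesis
      using Lim_transform_eventually[OF tendsto_const] by blast
  qed
qed

lemma cadlag01_T2:
  assumes "cadlag01 h"
  shows "cadlag01 (T2 u h)"
proof (rule cadlag01I)
  fix t :: real assume t: "0 \<le> t" "t < 1"
  show "(T2 u h \<longlongrightarrow> T2 u h t) (at_right t)"
  proof (cases "u \<le> t")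
    case True
    then have u: "1 - u > 0" using t by simp
    have tu: "0 \<le> (t - u) / (1 - u)" "(t - u) / (1 - u) < 1" using t u True by auto
    have "((\<lambda>s. h ((s - u) / (1 - u))) \<longlongrightarrow> h ((t - u) / (1 - u))) (at_right t)"
      using filterlim_compose[OF cadlag01_right[OF assms tu] filterlim_affine_at_right[OF u, of u t]]
      by simp
    then have "((\<lambda>s. (1 - u) * h ((s - u) / (1 - u))) \<longlongrightarrow> (1 - u) * h ((t - u) / (1 - u))) (at_right t)"
      by (auto intro: tendsto_intros)
    moreover have "eventually (\<lambda>s. (1 - u) * h ((s - u) / (1 - u)) = T2 u h s) (at_right t)"
      using eventually_at_right_greater[OF True]
      by eventually_elim (use u in \<open>auto simp: T2_def max_def divide_le_0_iff\<close>)
    ultimately show ?thesis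
      using True tu u Lim_transform_eventually[of "\<lambda>s. (1 - u) * h ((s - u) / (1 - u))"]
      by (simp add: T2_def)
  next
    case False
    then have "eventually (\<lambda>s. 0 = T2 u h s) (at_right t)"
      using eventually_at_right_less[of t u] by (auto simp: T2_def elim!: eventually_mono)
    then have "(T2 u h \<longlongrightarrow> 0) (at_right t)"
      by (rule Lim_transform_eventually[OF tendsto_const])
    then show ?thesis using False by (simp add: T2_def)
  qed
next
  fix t :: real assume t: "0 < t" "t \<le> 1"
  show "\<exists>l. (T2 u h \<longlongrightarrow> l) (at_left t)"
  proof (cases "u < t")
    case True
    then have u: "1 - u > 0" using t by simp
    have tu: "0 < (t - u) / (1 - u)" "(t - u) / (1 - u) \<le> 1" using t u True by auto
    obtain l where l: "(h \<longlongrightarrow> l) (at_left ((t - u) / (1 - u)))"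
      using cadlag01_left[OF assms tu] .
    have "((\<lambda>s. h ((s - u) / (1 - u))) \<longlongrightarrow> l) (at_left t)"
      using filterlim_compose[OF l filterlim_affine_at_left[OF u, of u t]]
      by simp
    then have "((\<lambda>s. (1 - u) * h ((s - u) / (1 - u))) \<longlongrightarrow> (1 - u) * l) (at_left t)"
      by (auto intro: tendsto_intros)
    moreover have "eventually (\<lambda>s. (1 - u) * h ((s - u) / (1 - u)) = T2 u h s) (at_left t)"
      using eventually_at_left_greater[OF True]
      by eventually_elim (use u in \<open>auto simp: T2_def max_def divide_le_0_iff\<close>)
    ultimately show ?thesis
      by (auto intro: Lim_transform_eventually)
  next
    case False
    then have "eventually (\<lambda>s. 0 = T2 u h s) (at_left t)"
      using eventually_at_left_less[of t u] by (auto simp: T2_def elim!: eventually_mono)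
    then show ?thesis
      using Lim_transform_eventually[OF tendsto_const] by blast
  qed
qed

lemma T1_argument: "0 \<le> t \<Longrightarrow> t < u \<Longrightarrow> min 1 (t / u) \<in> {0..1::real}"
  by auto

text \<open>The degenerate case u = t = 1 is covered, since 0 / 0 = 0 stays in range.\<close>

lemma T2_argument: "t \<le> 1 \<Longrightarrow> u \<le> t \<Longrightarrow> max 0 ((t - u) / (1 - u)) \<in> {0..1::real}"
  by (auto simp: divide_le_eq_1)

lemma bcadlag_T1: "bcadlag h \<Longrightarrow> bcadlag (T1 u h)"
proof -
  assume h: "bcadlag h"
  then obtain B where B: "\<And>t. t \<in> {0..1} \<Longrightarrow> \<bar>h t\<bar> \<le> B"
    using bcadlag_bound by blast
  have "\<bar>T1 u h t\<bar> \<le> \<bar>u\<bar> * B" if "t \<in> {0..1}" for t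
    using B[OF T1_argument[of t u]] B[of 0] that
    by (auto simp: T1_def abs_mult intro!: mult_left_mono mult_nonneg_nonneg)
  then show ?thesis
    using h by (intro bcadlagI cadlag01_T1) (auto simp: bcadlag_def)
qed

lemma bcadlag_T2: "bcadlag h \<Longrightarrow> bcadlag (T2 u h)"
proof -
  assume h: "bcadlag h"
  then obtain B where B: "\<And>t. t \<in> {0..1} \<Longrightarrow> \<bar>h t\<bar> \<le> B"
    using bcadlag_bound by blast
  have "\<bar>T2 u h t\<bar> \<le> \<bar>1 - u\<bar> * B" if "t \<in> {0..1}" for t
    using B[OF T2_argument[of t u]] B[of 0] that
    by (auto simp: T2_def abs_mult intro!: mult_left_mono mult_nonneg_nonneg)
  then show ?thesis
    using h by (intro bcadlagI cadlag01_T2) (auto simp: bcadlag_def)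
qed

text \<open>Gluing at \<open>u\<close>: \<open>g\<close> is only evaluated to the left of \<open>u\<close>, so that its extension by a
  continuous function up to and including \<open>u\<close> is all that matters.\<close>
lemma bcadlag_step:
  assumes "continuous_on {0..min 1 u} g"
  shows "bcadlag (\<lambda>t. if t < u then g t else c)"
proof -
  let ?f = "\<lambda>t. if t < u then g t else c"
  have "bounded (g ` {0..min 1 u})"
    using assms by (intro compact_imp_bounded compact_continuous_image) auto
  then have "bounded (insert c (g ` {0..min 1 u}))" by simp
  then have 1: "bounded (?f ` {0..1})"
    by (rule bounded_subset) auto
  have "(?f \<longlongrightarrow> ?f t) (at_right t)" if t: "0 \<le> t" "t < 1" for t
  proof (cases "t < u")
    case True
    have "(g \<longlongrightarrow> g t) (at t within {0..min 1 u})"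
      using assms t True by (auto simp: continuous_on_def)
    then have "(g \<longlongrightarrow> g t) (at t within {t..min 1 u})"
      by (rule tendsto_within_subset) (use t in auto)
    then have "(g \<longlongrightarrow> g t) (at_right t)"
      using t True by (simp add: at_within_Icc_at_right)
    moreover have "eventually (\<lambda>s. g s = ?f s) (at_right t)"
      using eventually_at_right_less[OF True] by eventually_elim auto
    ultimately show ?thesis using True by (simp add: Lim_transform_eventually)
  next
    case False
    have "eventually (\<lambda>s. c = ?f s) (at_right t)"
      using eventually_at_right_greater[of t t] False by (auto elim!: eventually_mono)
    then show ?thesis using False by (auto intro: Lim_transform_eventually[OF tendsto_const])
  qed
  moreover have "\<exists>l. (?f \<longlongrightarrow> l) (at_left t)" if t: "0 < t" "t \<le> 1" for t
  proof (cases "t \<le> u")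
    case True
    have "(g \<longlongrightarrow> g t) (at t within {0..min 1 u})"
      using assms t True by (auto simp: continuous_on_def)
    then have "(g \<longlongrightarrow> g t) (at t within {0..t})"
      by (rule tendsto_within_subset) (use t True in auto)
    then have "(g \<longlongrightarrow> g t) (at_left t)"
      using t by (simp add: at_within_Icc_at_left)
    moreover have "eventually (\<lambda>s. g s = ?f s) (at_left t)"
      using eventually_at_left_less[OF True] by eventually_elim auto
    ultimately have "(?f \<longlongrightarrow> g t) (at_left t)" by (rule Lim_transform_eventually)
    then show ?thesis ..
  next
    case False
    then have "eventually (\<lambda>s. c = ?f s) (at_left t)"
      using eventually_at_left_greater[of u t] by (auto elim!: eventually_mono)
    then have "(?f \<longlongrightarrow> c) (at_left t)" by (rule Lim_transform_eventually[OF tendsto_const])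
    then show ?thesis ..
  qed
  ultimately show ?thesis
    using 1 by (auto simp: bcadlag_def intro!: cadlag01I)
qed

text \<open>As a function of t the toll is continuous up to the split point and constant from there
  on, so \<open>bcadlag_step\<close> applies. Continuity of \<open>xlnx\<close> at 0 enters because
  t reaches the split point.\<close>

lemma bcadlag_Cfun: "bcadlag (Cfun U v \<omega>)"
proof -
  let ?x = "U v \<omega>"
  have "continuous_on {0..min 1 ?x}
      (\<lambda>t. Ccost ?x + 2 * (-1 + ?x + xlnx (1 - t) - xlnx (1 - ?x) - xlnx (?x - t)))"
    by (intro continuous_intros continuous_on_compose2[OF continuous_on_xlnx]) auto
  from bcadlag_step[OF this, of "Ccost ?x + ?x * Qlim U (v @ [1]) \<omega>"]
  show ?thesis
    by (rule arg_cong[where f = bcadlag, THEN iffD1, rotated]) (auto simp: Cfun_def Ccost2_def fun_eq_iff)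
qed

text \<open>This holds at every sample point, even where a label leaves [0,1] or the sums behind
  \<open>Qlim\<close> diverge. That is the form which \<open>measurable_supnorm\<close> asks
  for.\<close>

lemma bcadlag_Rm: "bcadlag (Rm U v m \<omega>)"
proof (induction m arbitrary: v)
  case 0
  then show ?case by (simp add: Rm_0[abs_def])
next
  case (Suc m)
  then show ?case
    unfolding Rm_Suc[abs_def] by (intro bcadlag_add bcadlag_T1 bcadlag_T2 bcadlag_Cfun)
qed

text \<open>Right continuity is the usual three-epsilon argument. For a left limit of g, the left
  limits of the f n are Cauchy, as their distances are bounded by uniform distances of the
  functions; their limit is then the left limit of g.\<close>

lemma bcadlag_uniform_limit:
  assumes f: "\<And>n. bcadlag (f n)" and lim: "uniform_limit {0..1} f g sequentially"
  shows "bcadlag g"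
proof -
  have close: "eventually (\<lambda>n. \<forall>t\<in>{0..1}. dist (f n t) (g t) < e) sequentially" if "e > 0" for e
    using lim that by (auto simp: uniform_limit_iff)
  have evr: "eventually (\<lambda>s. s \<in> {0..1}) (at_right t)" if "0 \<le> t" "t < 1" for t :: real
    using eventually_at_right_less[OF that(2)] eventually_at_right_greater[OF that(1)]
    by eventually_elim auto
  have evl: "eventually (\<lambda>s. s \<in> {0..1}) (at_left t)" if "0 < t" "t \<le> 1" for t :: real
    using eventually_at_left_less[OF that(2)] eventually_at_left_greater[OF that(1)]
    by eventually_elim auto
  have "(g \<longlongrightarrow> g t) (at_right t)" if t: "0 \<le> t" "t < 1" for t
  proof (rule tendstoI)
    fix e :: real assume "e > 0"
    then have "e / 3 > 0" by simp
    then obtain n where n: "\<And>t. t \<in> {0..1} \<Longrightarrow> dist (f n t) (g t) < e / 3"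
      using eventually_happens'[OF sequentially_bot close] by blast
    have "eventually (\<lambda>s. dist (f n s) (f n t) < e / 3) (at_right t)"
      using cadlag01_right[OF _ t] f[of n] \<open>e > 0\<close> by (intro tendstoD) (auto simp: bcadlag_def)
    with evr[OF t] show "eventually (\<lambda>s. dist (g s) (g t) < e) (at_right t)"
    proof eventually_elim
      case (elim s)
      then show ?case using n[of s] n[of t] t
        by (intro dist_triangle_third[of "g s" "f n s" e "f n t" "g t"]) (auto simp: dist_commute)
    qed
  qed
  moreover have "\<exists>l. (g \<longlongrightarrow> l) (at_left t)" if t: "0 < t" "t \<le> 1" for t
  proof -
    have "\<exists>l. (f n \<longlongrightarrow> l) (at_left t)" for n
      using f[of n] t by (auto simp: bcadlag_def elim: cadlag01_left)
    then obtain l where l: "\<And>n. (f n \<longlongrightarrow> l n) (at_left t)" by metis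
    have "Cauchy l"
    proof (rule metric_CauchyI)
      fix e :: real assume e: "e > 0"
      then have "e / 3 > 0" by simp
      then obtain N where N: "\<And>n t. n \<ge> N \<Longrightarrow> t \<in> {0..1} \<Longrightarrow> dist (f n t) (g t) < e / 3"
        using close unfolding eventually_sequentially by blast
      have "dist (l m) (l n) < e" if mn: "m \<ge> N" "n \<ge> N" for m n
      proof -
        have "((\<lambda>s. dist (f m s) (f n s)) \<longlongrightarrow> dist (l m) (l n)) (at_left t)"
          by (intro tendsto_dist l)
        moreover have "eventually (\<lambda>s. dist (f m s) (f n s) \<le> 2 * e / 3) (at_left t)"
          using evl[OF t]
        proof eventually_elim
          case (elim s)
          then show ?case
            using N[OF mn(1), of s] N[OF mn(2), of s] dist_triangle2[of "f m s" "f n s" "g s"] by simp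
        qed
        ultimately have "dist (l m) (l n) \<le> 2 * e / 3"
          by (intro tendsto_upperbound[of _ _ "at_left t"]) (auto simp: trivial_limit_at_left_real)
        then show ?thesis using e by simp
      qed
      then show "\<exists>N. \<forall>m\<ge>N. \<forall>n\<ge>N. dist (l m) (l n) < e" by blast
    qed
    then obtain L where L: "l \<longlonglongrightarrow> L" by (auto simp: Cauchy_convergent_iff convergent_def)
    have "(g \<longlongrightarrow> L) (at_left t)"
    proof (rule tendstoI)
      fix e :: real assume e: "e > 0"
      have "eventually (\<lambda>n. (\<forall>t\<in>{0..1}. dist (f n t) (g t) < e / 3) \<and> dist (l n) L < e / 3) sequentially"
        using e by (intro eventually_conj close tendstoD[OF L]) auto
      then obtain n where n: "\<And>t. t \<in> {0..1} \<Longrightarrow> dist (f n t) (g t) < e / 3" "dist (l n) L < e / 3"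
        using eventually_happens'[OF sequentially_bot] by blast
      have "eventually (\<lambda>s. dist (f n s) (l n) < e / 3) (at_left t)"
        using l[of n] e by (intro tendstoD) auto
      with evl[OF t] show "eventually (\<lambda>s. dist (g s) L < e) (at_left t)"
      proof eventually_elim
        case (elim s)
        then show ?case using n(1)[of s] n(2)
          by (intro dist_triangle_third[of "g s" "f n s" e "l n" L]) (auto simp: dist_commute)
      qed
    qed
    then show ?thesis by blast
  qed
  ultimately have "cadlag01 g" by (intro cadlag01I)
  show ?thesis
  proof -
    obtain n where n: "\<And>t. t \<in> {0..1} \<Longrightarrow> dist (f n t) (g t) < 1"
      using eventually_happens'[OF sequentially_bot close[of 1]] zero_less_one by blast
    obtain B where B: "\<And>t. t \<in> {0..1} \<Longrightarrow> \<bar>f n t\<bar> \<le> B"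
      using bcadlag_bound[OF f[of n]] by blast
    have "\<bar>g t\<bar> \<le> B + 1" if "t \<in> {0..1}" for t
      using n[OF that] B[OF that] by (auto simp: dist_real_def)
    with \<open>cadlag01 g\<close> show ?thesis by (rule bcadlagI)
  qed
qed

subsection \<open>The supremum norm\<close>

lemma bcadlag_bdd_above: "bcadlag f \<Longrightarrow> bdd_above ((\<lambda>t. \<bar>f t\<bar>) ` {0..1})"
  by (auto simp: bcadlag_def bounded_iff bdd_above_def)

lemma abs_le_supnorm: "bcadlag f \<Longrightarrow> t \<in> {0..1} \<Longrightarrow> \<bar>f t\<bar> \<le> supnorm f"
  unfolding supnorm_def by (intro cSUP_upper bcadlag_bdd_above)

lemma supnorm_le: "(\<And>t. t \<in> {0..1} \<Longrightarrow> \<bar>f t\<bar> \<le> B) \<Longrightarrow> supnorm f \<le> B"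
  unfolding supnorm_def by (intro cSUP_least) auto

lemma supnorm_nonneg: "bcadlag f \<Longrightarrow> 0 \<le> supnorm f"
  using abs_le_supnorm[of f 0] by simp

lemma supnorm_step_le:
  assumes "bcadlag h1" "bcadlag h2" "0 \<le> u" "u \<le> 1"
    and c: "\<And>t. t \<in> {0..1} \<Longrightarrow> \<bar>c t\<bar> \<le> B"
  shows "supnorm (\<lambda>t. T1 u h1 t + T2 u h2 t + c t) \<le> max (u * supnorm h1) ((1 - u) * supnorm h2) + B"
proof (rule supnorm_le)
  fix t :: real assume t: "t \<in> {0..1}"
  have "\<bar>T1 u h1 t + T2 u h2 t\<bar> \<le> max (u * supnorm h1) ((1 - u) * supnorm h2)"
  proof (cases "t < u")
    case True
    then have "\<bar>h1 (min 1 (t / u))\<bar> \<le> supnorm h1"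
      using t assms by (intro abs_le_supnorm T1_argument) auto
    then show ?thesis using True assms
      by (auto simp: T1_def T2_def abs_mult intro!: max.coboundedI1 mult_left_mono)
  next
    case False
    then have "\<bar>h2 (max 0 ((t - u) / (1 - u)))\<bar> \<le> supnorm h2"
      using t assms by (intro abs_le_supnorm T2_argument) auto
    then show ?thesis using False assms
      by (auto simp: T1_def T2_def abs_mult intro!: max.coboundedI2 mult_left_mono)
  qed
  then show "\<bar>T1 u h1 t + T2 u h2 t + c t\<bar> \<le> max (u * supnorm h1) ((1 - u) * supnorm h2) + B"
    using c[OF t] by linarith
qed

lemma tendsto_supnorm:
  assumes "\<And>n. bcadlag (f n)" "bcadlag g" "uniform_limit {0..1} f g sequentially"
  shows "(\<lambda>n. supnorm (f n)) \<longlonglongrightarrow> supnorm g"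
proof (rule LIMSEQ_I)
  fix e :: real assume e: "e > 0"
  have "eventually (\<lambda>n. \<forall>t\<in>{0..1}. dist (f n t) (g t) < e / 2) sequentially"
    using assms(3) half_gt_zero[OF e] unfolding uniform_limit_iff by blast
  then have "eventually (\<lambda>n. norm (supnorm (f n) - supnorm g) < e) sequentially"
  proof eventually_elim
    case (elim n)
    have "supnorm (f n) \<le> supnorm g + e / 2"
    proof (rule supnorm_le)
      fix t :: real assume "t \<in> {0..1}"
      then show "\<bar>f n t\<bar> \<le> supnorm g + e / 2"
        using bspec[OF elim, of t] abs_le_supnorm[OF assms(2), of t] by (simp add: dist_real_def abs_if split: if_splits)
    qed
    moreover have "supnorm g \<le> supnorm (f n) + e / 2"
    proof (rule supnorm_le)
      fix t :: real assume "t \<in> {0..1}"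
      then show "\<bar>g t\<bar> \<le> supnorm (f n) + e / 2"
        using bspec[OF elim, of t] abs_le_supnorm[OF assms(1)[of n], of t] by (simp add: dist_real_def abs_if split: if_splits)
    qed
    ultimately show ?case using e by simp
  qed
  then show "\<exists>no. \<forall>n\<ge>no. norm (supnorm (f n) - supnorm g) < e"
    by (auto simp: eventually_sequentially)
qed

text \<open>By right continuity the supremum may be restricted to a countable set, which makes the
  supremum norm measurable on the whole (not necessarily complete) space.\<close>
lemma supnorm_eq_countable:
  assumes "bcadlag f"
  shows "supnorm f = (SUP t\<in>insert 1 (\<rat> \<inter> {0..1}). \<bar>f t\<bar>)"
proof (rule antisym)
  let ?I = "insert 1 (\<rat> \<inter> {0..1}) :: real set"
  have bdd: "bdd_above ((\<lambda>t. \<bar>f t\<bar>) ` ?I)"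
    by (rule bdd_above_mono[OF bcadlag_bdd_above[OF assms]]) auto
  have up: "\<bar>f t\<bar> \<le> (SUP t\<in>?I. \<bar>f t\<bar>)" if "t \<in> ?I" for t
    using bdd that by (intro cSUP_upper)
  show "supnorm f \<le> (SUP t\<in>?I. \<bar>f t\<bar>)"
  proof (rule supnorm_le)
    fix t :: real assume t: "t \<in> {0..1}"
    show "\<bar>f t\<bar> \<le> (SUP t\<in>?I. \<bar>f t\<bar>)"
    \<comment> \<open>Approximation from the right is impossible at 1, so that point has to lie in
      the countable set itself.\<close>
    proof (cases "t = 1")
      case True
      then show ?thesis using up[of 1] by simp
    next
      case False
      with t have t: "0 \<le> t" "t < 1" by auto
      have lim: "((\<lambda>s. \<bar>f s\<bar>) \<longlongrightarrow> \<bar>f t\<bar>) (at_right t)"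
        using assms t by (intro tendsto_rabs cadlag01_right) (auto simp: bcadlag_def)
      show ?thesis
      proof (rule ccontr)
        assume "\<not> \<bar>f t\<bar> \<le> (SUP t\<in>?I. \<bar>f t\<bar>)"
        then have "eventually (\<lambda>s. \<bar>f s\<bar> > (SUP t\<in>?I. \<bar>f t\<bar>)) (at_right t)"
          by (intro order_tendstoD(1)[OF lim]) simp
        then obtain b where b: "b > t" "\<And>s. t < s \<Longrightarrow> s < b \<Longrightarrow> \<bar>f s\<bar> > (SUP t\<in>?I. \<bar>f t\<bar>)"
          by (auto simp: eventually_at_right_field)
        obtain q where "q \<in> \<rat>" "t < q" "q < min b 1"
          using Rats_dense_in_real[of t "min b 1"] b t by auto
        then show False using b(2)[of q] up[of q] t by auto
      qed
    qed
  qed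
  show "(SUP t\<in>?I. \<bar>f t\<bar>) \<le> supnorm f"
    by (intro cSUP_least abs_le_supnorm assms) auto
qed

lemma measurable_supnorm:
  assumes "\<And>\<omega>. bcadlag (f \<omega>)"
    and [measurable]: "\<And>t. t \<in> {0..1} \<Longrightarrow> (\<lambda>\<omega>. f \<omega> t) \<in> borel_measurable M"
  shows "(\<lambda>\<omega>. supnorm (f \<omega>)) \<in> borel_measurable M"
proof -
  let ?I = "insert 1 (\<rat> \<inter> {0..1}) :: real set"
  have "(\<lambda>\<omega>. SUP t\<in>?I. \<bar>f \<omega> t\<bar>) \<in> borel_measurable M"
  proof (rule borel_measurable_cSUP)
    show "countable ?I" using countable_rat by auto
    show "(\<lambda>\<omega>. \<bar>f \<omega> t\<bar>) \<in> borel_measurable M" if "t \<in> ?I" for t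
      using that by (intro borel_measurable_abs assms(2)) auto
    show "bdd_above ((\<lambda>t. \<bar>f \<omega> t\<bar>) ` ?I)" for \<omega>
      by (rule bdd_above_mono[OF bcadlag_bdd_above[OF assms(1)]]) auto
  qed
  then show ?thesis using supnorm_eq_countable[OF assms(1)] by simp
qed

subsection \<open>The canonical product space\<close>

text \<open>Written as the very density that occurs in the hypothesis on the
  \<open>U v\<close>.\<close>

definition unif :: "real measure" where
  "unif = density lborel (indicator {0..1})"

definition Pm :: "(nat list \<Rightarrow> real) measure" where
  "Pm = PiM Vset (\<lambda>_. unif)"

lemma sets_unif [measurable_cong, simp]: "sets unif = sets borel"
  by (simp add: unif_def)

lemma space_unif [simp]: "space unif = UNIV"
  by (simp add: unif_def)

lemma prob_space_unif: "prob_space unif"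
  by (rule prob_spaceI) (simp add: unif_def emeasure_density)

interpretation unif: prob_space unif
  by (rule prob_space_unif)

interpretation Pm: prob_space Pm
  unfolding Pm_def by (intro prob_space_PiM prob_space_unif)

interpretation Pm_pair: pair_prob_space Pm Pm ..

lemma sets_Pm: "sets Pm = sets (PiM Vset (\<lambda>_. borel))"
  unfolding Pm_def by (intro sets_PiM_cong) simp_all

lemma measurable_coord [measurable]: "w \<in> Vset \<Longrightarrow> coord w \<in> borel_measurable Pm"
  unfolding measurable_cong_sets[OF sets_Pm refl] by simp

lemma measurable_restrict_Pm:
  "(\<And>w. w \<in> Vset \<Longrightarrow> (\<lambda>x. f w x) \<in> borel_measurable N) \<Longrightarrow> (\<lambda>x. \<lambda>w\<in>Vset. f w x) \<in> measurable N Pm"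
  unfolding measurable_cong_sets[OF refl sets_Pm] by (rule measurable_restrict)

lemma measurable_Vshift [measurable]: "v \<in> Vset \<Longrightarrow> Vshift v \<in> measurable Pm Pm"
  unfolding Vshift_def by (rule measurable_restrict_Pm) simp

lemma distr_coord: "w \<in> Vset \<Longrightarrow> distr Pm borel (coord w) = unif"
proof -
  assume w: "w \<in> Vset"
  have "distr Pm borel (coord w) = distr Pm unif (coord w)"
    by (intro distr_cong) auto
  then show ?thesis
    using distr_PiM_component[of Vset "\<lambda>_. unif", OF prob_space_unif w] by (simp add: Pm_def)
qed

text \<open>Shifting reindexes the product along the injection w -> v @ w, and all factors are
  equal.\<close>

lemma distr_Vshift: "v \<in> Vset \<Longrightarrow> distr Pm Pm (Vshift v) = Pm"
  using distr_PiM_reindex[of Vset "\<lambda>_. unif" "(@) v" Vset]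
  by (auto simp: Pm_def Vshift_def[abs_def] prob_space_unif inj_on_def)

lemma restrict_space_Pm: "x \<in> space Pm \<Longrightarrow> restrict x Vset = x"
  by (simp add: Pm_def space_PiM)

lemma indep_coord: "Pm.indep_vars (\<lambda>_. borel) coord Vset"
proof (subst Pm.indep_vars_iff_distr_eq_PiM')
  have "distr Pm (PiM Vset (\<lambda>_. borel)) (\<lambda>x. restrict x Vset) = distr Pm Pm (\<lambda>x. x)"
    by (intro distr_cong) (auto simp: sets_Pm restrict_space_Pm)
  also have "\<dots> = PiM Vset (\<lambda>i. distr Pm borel (coord i))"
    unfolding distr_id2 by (simp add: Pm_def cong: PiM_cong)
       (intro PiM_cong refl; simp add: distr_coord[unfolded Pm_def])
  finally show "distr Pm (PiM Vset (\<lambda>_. borel)) (\<lambda>x. restrict x Vset) = PiM Vset (\<lambda>i. distr Pm borel (coord i))" .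
qed auto

text \<open>Independence and uniformity of the given family are used here and nowhere else: they say
  that the whole tree has law \<open>Pm\<close>, which shifts preserve. Afterwards every almost sure
  statement and every integral can be pulled back from \<open>Pm\<close>.\<close>

lemma distr_family:
  assumes "prob_space M" and "prob_space.indep_vars M (\<lambda>_. borel) U Vset"
    and U: "\<And>v. v \<in> Vset \<Longrightarrow> distributed M lborel (U v) (indicator {0..1})"
    and v: "v \<in> Vset"
  shows "(\<lambda>\<omega>. Vshift v (\<lambda>w. U w \<omega>)) \<in> measurable M Pm"
    and "distr M Pm (\<lambda>\<omega>. Vshift v (\<lambda>w. U w \<omega>)) = Pm"
proof -
  interpret prob_space M by fact
  have U_meas [measurable]: "U w \<in> borel_measurable M" if "w \<in> Vset" for w
    using U[OF that] by (simp add: distributed_def)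
  have U_distr: "distr M borel (U w) = unif" if "w \<in> Vset" for w
  proof -
    have "distr M borel (U w) = distr M lborel (U w)" by (intro distr_cong) auto
    then show ?thesis using U[OF that] by (simp add: distributed_def unif_def)
  qed
  show "(\<lambda>\<omega>. Vshift v (\<lambda>w. U w \<omega>)) \<in> measurable M Pm"
    unfolding Vshift_def using v by (intro measurable_restrict_Pm) simp
  have m: "(\<lambda>\<omega>. \<lambda>w\<in>Vset. U w \<omega>) \<in> measurable M Pm"
    by (intro measurable_restrict_Pm) simp
  have "distr M (PiM Vset (\<lambda>_. borel)) (\<lambda>\<omega>. \<lambda>w\<in>Vset. U w \<omega>) = PiM Vset (\<lambda>w. distr M borel (U w))"
    using assms(2) by (subst (asm) indep_vars_iff_distr_eq_PiM') auto
  also have "\<dots> = Pm"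
    unfolding Pm_def by (intro PiM_cong refl) (simp add: U_distr)
  finally have "distr M Pm (\<lambda>\<omega>. \<lambda>w\<in>Vset. U w \<omega>) = Pm"
    using sets_Pm by (metis (no_types, lifting) distr_cong)
  then have "distr (distr M Pm (\<lambda>\<omega>. \<lambda>w\<in>Vset. U w \<omega>)) Pm (Vshift v) = Pm"
    using distr_Vshift[OF v] by simp
  then show "distr M Pm (\<lambda>\<omega>. Vshift v (\<lambda>w. U w \<omega>)) = Pm"
    using v by (subst (asm) distr_distr[OF _ m]) (auto simp: Vshift_def o_def cong: restrict_cong)
qed

text \<open>Words beginning with 1 and words beginning with 2 form disjoint blocks of independent
  coordinates.\<close>

lemma indep_shifts: "Pm.indep_var Pm (Vshift [1]) Pm (Vshift [2])"
proof -
  \<comment> \<open>\<open>?Y i\<close> recovers the shift from the restriction to its own block,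
    which puts the claim into the form of independence of restrictions.\<close>
  let ?Y = "\<lambda>i x. \<lambda>w\<in>Vset. x (i # w) :: real" 
  have Y: "?Y i \<in> measurable (PiM ((#) i ` Vset) (\<lambda>_. borel)) Pm" for i :: nat
    by (intro measurable_restrict_Pm measurable_component_singleton) auto
  have "Pm.indep_var Pm (?Y 1 \<circ> (\<lambda>x. restrict x ((#) 1 ` Vset))) Pm (?Y 2 \<circ> (\<lambda>x. restrict x ((#) 2 ` Vset)))"
    by (rule Pm.indep_var_compose[OF Pm.indep_var_restrict[OF indep_coord] Y Y]) auto
  moreover have "?Y i \<circ> (\<lambda>x. restrict x ((#) i ` Vset)) = Vshift [i]" for i
    by (auto simp: fun_eq_iff Vshift_def)
  ultimately show ?thesis by simp
qed

lemma distr_shifts: "distr Pm (Pm \<Otimes>\<^sub>M Pm) (\<lambda>x. (Vshift [1] x, Vshift [2] x)) = Pm \<Otimes>\<^sub>M Pm"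
  using indep_shifts unfolding Pm.indep_var_distribution_eq by (simp add: distr_Vshift)

text \<open>The empty word against all the others is one more split into disjoint blocks; within the
  second block the joint law of the subtrees is given by \<open>distr_shifts\<close>.\<close>

lemma distr_root_shifts:
  "distr Pm (borel \<Otimes>\<^sub>M (Pm \<Otimes>\<^sub>M Pm)) (\<lambda>x. (x [], Vshift [1] x, Vshift [2] x)) = unif \<Otimes>\<^sub>M (Pm \<Otimes>\<^sub>M Pm)"
proof -
  let ?A = "{[]} :: nat list set" and ?B = "Vset - {[]}"
  let ?PA = "PiM ?A (\<lambda>_. borel) :: (nat list \<Rightarrow> real) measure"
  let ?PB = "PiM ?B (\<lambda>_. borel) :: (nat list \<Rightarrow> real) measure"
  let ?Y = "\<lambda>i x. \<lambda>w\<in>Vset. x (i # w) :: real"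
  let ?S = "\<lambda>x. (Vshift [1] x, Vshift [2] x)"
  have Yi: "?Y i \<in> measurable ?PB Pm" if "i = 1 \<or> i = 2" for i :: nat
    using that by (intro measurable_restrict_Pm measurable_component_singleton) auto
  have Y: "(\<lambda>x. (?Y 1 x, ?Y 2 x)) \<in> measurable ?PB (Pm \<Otimes>\<^sub>M Pm)"
    by (intro measurable_Pair Yi) auto
  have C: "coord [] \<in> measurable ?PA borel"
    by (rule measurable_component_singleton) simp
  have rA: "(\<lambda>x. restrict x ?A) \<in> measurable Pm ?PA" and rB: "(\<lambda>x. restrict x ?B) \<in> measurable Pm ?PB"
    by (intro measurable_restrict; simp)+
  have eq: "distr Pm ?PA (\<lambda>x. restrict x ?A) \<Otimes>\<^sub>M distr Pm ?PB (\<lambda>x. restrict x ?B)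
      = distr Pm (?PA \<Otimes>\<^sub>M ?PB) (\<lambda>x. (restrict x ?A, restrict x ?B))"
    using Pm.indep_var_restrict[OF indep_coord, of ?A ?B]
    unfolding Pm.indep_var_distribution_eq by auto
  have dA: "distr (distr Pm ?PA (\<lambda>x. restrict x ?A)) borel (coord []) = unif"
    by (subst distr_distr[OF C rA]) (simp add: o_def distr_coord)
  have dB: "distr (distr Pm ?PB (\<lambda>x. restrict x ?B)) (Pm \<Otimes>\<^sub>M Pm) (\<lambda>x. (?Y 1 x, ?Y 2 x)) = Pm \<Otimes>\<^sub>M Pm"
  proof -
    have "(\<lambda>x. (?Y 1 x, ?Y 2 x)) \<circ> (\<lambda>x. restrict x ?B) = ?S"
      by (auto simp: fun_eq_iff Vshift_def)
    then show ?thesis by (subst distr_distr[OF Y rB]) (simp add: distr_shifts del: One_nat_def)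
  qed
  have "unif \<Otimes>\<^sub>M (Pm \<Otimes>\<^sub>M Pm) = distr (distr Pm ?PA (\<lambda>x. restrict x ?A)) borel (coord [])
      \<Otimes>\<^sub>M distr (distr Pm ?PB (\<lambda>x. restrict x ?B)) (Pm \<Otimes>\<^sub>M Pm) (\<lambda>x. (?Y 1 x, ?Y 2 x))"
    by (simp only: dA dB)
  also have "\<dots> = distr (distr Pm ?PA (\<lambda>x. restrict x ?A) \<Otimes>\<^sub>M distr Pm ?PB (\<lambda>x. restrict x ?B))
      (borel \<Otimes>\<^sub>M (Pm \<Otimes>\<^sub>M Pm)) (\<lambda>(a, b). (coord [] a, ?Y 1 b, ?Y 2 b))"
    by (rule pair_measure_distr)
      (use C Y in \<open>simp_all only: measurable_distr_eq1 dB Pm_pair.P.sigma_finite_measure_axioms\<close>)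
  also have "\<dots> = distr Pm (borel \<Otimes>\<^sub>M (Pm \<Otimes>\<^sub>M Pm)) ((\<lambda>(a, b). (coord [] a, ?Y 1 b, ?Y 2 b)) \<circ> (\<lambda>x. (restrict x ?A, restrict x ?B)))"
    unfolding eq
  proof (rule distr_distr)
    show "(\<lambda>(a, b). (coord [] a, ?Y 1 b, ?Y 2 b)) \<in> measurable (?PA \<Otimes>\<^sub>M ?PB) (borel \<Otimes>\<^sub>M (Pm \<Otimes>\<^sub>M Pm))"
      unfolding split_beta
      by (intro measurable_Pair measurable_compose[OF measurable_fst C] measurable_compose[OF measurable_snd Yi]) auto
    show "(\<lambda>x. (restrict x ?A, restrict x ?B)) \<in> measurable Pm (?PA \<Otimes>\<^sub>M ?PB)"
      by (intro measurable_Pair rA rB)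
  qed
  also have "(\<lambda>(a, b). (coord [] a, ?Y 1 b, ?Y 2 b)) \<circ> (\<lambda>x. (restrict x ?A, restrict x ?B)) = (\<lambda>x. (x [], ?S x))"
    by (auto simp: fun_eq_iff Vshift_def)
  finally show ?thesis by simp
qed

text \<open>Tonelli for the decomposition at the root. Being free of integrability conditions, it
  serves the exponential moments and the L_p estimates alike.\<close>

lemma nn_integral_root_shifts:
  assumes F [measurable]: "(\<lambda>(u, y, z). F u y z) \<in> borel_measurable (borel \<Otimes>\<^sub>M (Pm \<Otimes>\<^sub>M Pm))"
  shows "(\<integral>\<^sup>+x. F (x []) (Vshift [1] x) (Vshift [2] x) \<partial>Pm) = (\<integral>\<^sup>+u. \<integral>\<^sup>+y. \<integral>\<^sup>+z. F u y z \<partial>Pm \<partial>Pm \<partial>unif)"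
proof -
  have F' [measurable]: "(\<lambda>(u, y, z). F u y z) \<in> borel_measurable (unif \<Otimes>\<^sub>M (Pm \<Otimes>\<^sub>M Pm))"
    by measurable
  have "(\<integral>\<^sup>+x. F (x []) (Vshift [1] x) (Vshift [2] x) \<partial>Pm) = 
    (\<integral>\<^sup>+p. (\<lambda>(u, y, z). F u y z) p \<partial>distr Pm (borel \<Otimes>\<^sub>M (Pm \<Otimes>\<^sub>M Pm)) (\<lambda>x. (x [], Vshift [1] x, Vshift [2] x)))"
    by (subst nn_integral_distr) auto
  also have "\<dots> = (\<integral>\<^sup>+u. \<integral>\<^sup>+q. (\<lambda>(u, y, z). F u y z) (u, q) \<partial>(Pm \<Otimes>\<^sub>M Pm) \<partial>unif)"
    unfolding distr_root_shifts by (rule Pm_pair.nn_integral_fst[symmetric]) simp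
  also have "\<dots> = (\<integral>\<^sup>+u. \<integral>\<^sup>+y. \<integral>\<^sup>+z. F u y z \<partial>Pm \<partial>Pm \<partial>unif)"
  proof (intro nn_integral_cong)
    fix u :: real assume "u \<in> space unif"
    have "(\<lambda>(y, z). F u y z) \<in> borel_measurable (Pm \<Otimes>\<^sub>M Pm)"
      using measurable_compose[OF measurable_Pair1' F, of u] by simp
    then show "(\<integral>\<^sup>+q. (\<lambda>(u, y, z). F u y z) (u, q) \<partial>(Pm \<Otimes>\<^sub>M Pm)) = (\<integral>\<^sup>+y. \<integral>\<^sup>+z. F u y z \<partial>Pm \<partial>Pm)"
      using Pm.nn_integral_fst[of "\<lambda>(y, z). F u y z" Pm] by simp
  qed
  finally show ?thesis .
qed

text \<open>A uniform variable gives full mass to the open interval, so the generic point of the product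
  space has all its coordinates in it.\<close>
definition generic_tree :: "(nat list \<Rightarrow> real) \<Rightarrow> bool" where
  "generic_tree x \<longleftrightarrow> (\<forall>w\<in>Vset. 0 < x w \<and> x w < 1)"

lemma AE_unif: "AE u in unif. 0 < u \<and> u < 1"
proof -
  have "AE u in lborel. u \<noteq> 0 \<and> u \<noteq> (1::real)"
    using AE_lborel_singleton[of "0::real"] AE_lborel_singleton[of "1::real"] by eventually_elim auto
  then show ?thesis
    unfolding unif_def by (subst AE_density) (simp, elim eventually_mono, auto simp: indicator_def)
qed

lemma AE_generic_tree: "AE x in Pm. generic_tree x"
proof -
  have "AE x in Pm. 0 < x w \<and> x w < 1" if w: "w \<in> Vset" for w
    using AE_distrD[OF measurable_coord[OF w], of "\<lambda>u. 0 < u \<and> u < 1"] AE_unif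
    unfolding distr_coord[OF w] .
  then show ?thesis
    unfolding generic_tree_def by (subst AE_ball_countable[OF countable_Vset]) auto
qed

lemma generic_tree_Nil: "generic_tree x \<Longrightarrow> 0 < x [] \<and> x [] < 1"
  by (simp add: generic_tree_def)

lemma generic_tree_Vshift: "generic_tree x \<Longrightarrow> v \<in> Vset \<Longrightarrow> generic_tree (Vshift v x)"
  by (auto simp: generic_tree_def Vshift_def)

subsection \<open>Canonical versions of the variables\<close>

abbreviation "qm \<equiv> Qm coord []"
abbreviation "ql \<equiv> Qlim coord []"
abbreviation "rm \<equiv> Rm coord []"

lemma qm_Suc: "qm (Suc m) x = Ccost (x []) + x [] * qm m (Vshift [1] x) + (1 - x []) * qm m (Vshift [2] x)"
  using Qm_Vshift[of coord "[1]" m x] Qm_Vshift[of coord "[2]" m x] by (simp add: Qm_Suc)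

lemma Cfun_coord: "Cfun coord [] x t = Ccost2 t (x []) + (if x [] \<le> t then x [] * ql (Vshift [1] x) else 0)"
  using Qlim_Vshift[of coord "[1]" x] by (simp add: Cfun_def)

lemma rm_Suc:
  "rm (Suc m) x t = T1 (x []) (rm m (Vshift [1] x)) t + T2 (x []) (rm m (Vshift [2] x)) t
     + Cfun coord [] x t"
  using Rm_Vshift[of coord "[1]" m x] Rm_Vshift[of coord "[2]" m x] by (simp add: Rm_Suc)

lemma ql_eq: "ql x = lim (\<lambda>m. qm m x)"
  by (simp add: Qlim_def Qm_def)

lemma measurable_qm [measurable]: "qm m \<in> borel_measurable Pm"
proof (induction m)
  case (Suc m)
  note Suc [measurable]
  show ?case unfolding qm_Suc[abs_def] by measurable
qed (simp add: Qm_def)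

lemma measurable_ql [measurable]: "ql \<in> borel_measurable Pm"
  unfolding ql_eq[abs_def] by measurable

lemma measurable_Cfun [measurable]: "(\<lambda>z. Cfun coord [] (fst z) (snd z)) \<in> borel_measurable (Pm \<Otimes>\<^sub>M borel)"
proof -
  have [measurable]: "(\<lambda>z. Ccost2 (snd z) (fst z [])) \<in> borel_measurable (Pm \<Otimes>\<^sub>M borel)"
    using measurable_compose[OF _ Ccost2_measurable, of "\<lambda>z. (snd z, fst z [])" "Pm \<Otimes>\<^sub>M borel"] by simp
  show ?thesis unfolding Cfun_coord by measurable
qed

text \<open>Joint measurability is the right induction hypothesis: the recursion evaluates the
  subtrees at a random time that depends on the root label.\<close>

lemma measurable_rm_pair: "(\<lambda>z. rm m (fst z) (snd z)) \<in> borel_measurable (Pm \<Otimes>\<^sub>M borel)"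
proof (induction m)
  case (Suc m)
  have *: "(\<lambda>z. rm m (f z) (g z)) \<in> borel_measurable N"
    if "f \<in> measurable N Pm" "g \<in> borel_measurable N" for f g and N :: "((nat list \<Rightarrow> real) \<times> real) measure"
    using measurable_compose[OF measurable_Pair[OF that] Suc] by simp
  have [measurable]:
    "(\<lambda>z. rm m (Vshift [1] (fst z)) (min 1 (snd z / fst z []))) \<in> borel_measurable (Pm \<Otimes>\<^sub>M borel)"
    "(\<lambda>z. rm m (Vshift [2] (fst z)) (max 0 ((snd z - fst z []) / (1 - fst z [])))) \<in> borel_measurable (Pm \<Otimes>\<^sub>M borel)"
    by (rule *; measurable)+
  show ?case unfolding rm_Suc T1_def T2_def by measurable
qed simp

lemma measurable_rm [measurable]: "(\<lambda>x. rm m x t) \<in> borel_measurable Pm"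
  using measurable_compose[OF measurable_Pair[OF measurable_ident measurable_const[of t borel]] measurable_rm_pair[of m]]
  by simp

subsection \<open>Almost sure convergence of the Quicksort variables\<close>

text \<open>A weighted split replaces Cauchy-Schwarz: f is at most (4/5)^m, or else at most (5/4)^m
  f^2. Any ratio strictly between 1 and 3/2 would serve as 5/4, since both 5/4 * 2/3 = 5/6 and 4/5
  have to be below 1.\<close>

lemma (in finite_measure) AE_summable_of_L2_geometric:
  fixes f :: "nat \<Rightarrow> 'a \<Rightarrow> real"
  assumes [measurable]: "\<And>m. f m \<in> borel_measurable M" and nn: "\<And>m x. 0 \<le> f m x"
    and bound: "\<And>m. (\<integral>\<^sup>+x. ennreal ((f m x)\<^sup>2) \<partial>M) \<le> ennreal (K * (2/3) ^ m)" and K: "K \<ge> 0"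
  shows "AE x in M. summable (\<lambda>m. f m x)"
proof -
  let ?C = "measure M (space M)"
  let ?b = "\<lambda>m. K * (5/6) ^ m + (4/5) ^ m * ?C :: real"
  have le: "(\<integral>\<^sup>+x. ennreal (f m x) \<partial>M) \<le> ennreal (?b m)" for m
  proof -
    have pt: "f m x \<le> (5/4) ^ m * (f m x)\<^sup>2 + (4/5) ^ m" for x
    proof (cases "f m x \<le> (4/5) ^ m")
      case True
      then show ?thesis by (simp add: add.commute add_increasing2)
    next
      case False
      then have "(5/4) ^ m * ((4/5) ^ m * f m x) \<le> (5/4) ^ m * (f m x * f m x)"
        using nn[of m x] by (intro mult_left_mono mult_right_mono) auto
      then have "f m x \<le> (5/4) ^ m * (f m x)\<^sup>2"
        by (simp add: power2_eq_square flip: mult.assoc power_mult_distrib)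
      then show ?thesis by (simp add: add_increasing2)
    qed
    have "(\<integral>\<^sup>+x. ennreal (f m x) \<partial>M) \<le> (\<integral>\<^sup>+x. ennreal ((5/4) ^ m) * ennreal ((f m x)\<^sup>2) + ennreal ((4/5) ^ m) \<partial>M)"
      using pt by (intro nn_integral_mono) (simp flip: ennreal_mult ennreal_plus)
    also have "\<dots> = ennreal ((5/4) ^ m) * (\<integral>\<^sup>+x. ennreal ((f m x)\<^sup>2) \<partial>M) + ennreal ((4/5) ^ m) * emeasure M (space M)"
      by (subst nn_integral_add) (auto simp: nn_integral_cmult)
    also have "\<dots> \<le> ennreal ((5/4) ^ m) * ennreal (K * (2/3) ^ m) + ennreal ((4/5) ^ m) * ennreal ?C"
      using bound[of m] by (intro add_mono mult_left_mono) (auto simp: emeasure_eq_measure)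
    also have "\<dots> = ennreal ((5/4) ^ m * (K * (2/3) ^ m) + (4/5) ^ m * ?C)"
      using K by (simp add: ennreal_mult ennreal_plus)
    also have "(5/4) ^ m * (K * (2/3) ^ m) + (4/5) ^ m * ?C = ?b m"
      by (simp add: mult.left_commute flip: power_mult_distrib)
    finally show ?thesis .
  qed
  have "summable ?b"
    by (intro summable_add summable_mult summable_mult2 summable_geometric) auto
  then have fin: "(\<Sum>m. ennreal (?b m)) \<noteq> top"
    using K by (intro ennreal_suminf_neq_top) auto
  have "(\<integral>\<^sup>+x. (\<Sum>m. ennreal (f m x)) \<partial>M) = (\<Sum>m. \<integral>\<^sup>+x. ennreal (f m x) \<partial>M)"
    by (intro nn_integral_suminf) simp
  also have "\<dots> \<le> (\<Sum>m. ennreal (?b m))"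
    by (intro suminf_le le) auto
  finally have "(\<integral>\<^sup>+x. (\<Sum>m. ennreal (f m x)) \<partial>M) \<noteq> \<infinity>"
    using fin by (auto simp: top_unique)
  then have "AE x in M. (\<Sum>m. ennreal (f m x)) \<noteq> \<infinity>"
    by (intro nn_integral_PInf_AE) auto
  then show ?thesis
    by eventually_elim (auto intro!: summable_suminf_not_top nn)
qed

section \<open>Integrals against the uniform law, and factorization over root and subtrees\<close>

lemma unif_integral:
  fixes f :: "real \<Rightarrow> real"
  assumes [measurable]: "f \<in> borel_measurable borel" and "continuous_on {0..1} f" "(f has_integral I) {0..1}"
  shows "integrable unif f" "integral\<^sup>L unif f = I"
proof -
  have eq: "unif = density lborel (\<lambda>x. ennreal (indicator {0..1} x))"
    by (simp add: unif_def ennreal_indicator)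
  have si: "set_integrable lborel {0..1} f"
    by (rule borel_integrable_atLeastAtMost') fact
  then show "integrable unif f"
    unfolding eq by (subst integrable_density) (auto simp: set_integrable_def)
  have "integral\<^sup>L unif f = (LBINT x:{0..1}. f x)"
    unfolding eq by (subst integral_density) (auto simp: set_lebesgue_integral_def)
  also have "\<dots> = I"
    using set_borel_integral_eq_integral(2)[OF si] assms(3) by (simp add: integral_unique)
  finally show "integral\<^sup>L unif f = I" .
qed

lemma continuous_on_Ccost: "continuous_on {0..1} Ccost"
  unfolding Ccost_def[abs_def]
  by (intro continuous_intros continuous_on_compose2[OF continuous_on_xlnx]) auto

lemma xlnx_has_derivative: "x > 0 \<Longrightarrow> (xlnx has_real_derivative ln x + 1) (at x)"
proof -
  assume x: "x > 0"
  have "((\<lambda>y. y * ln y) has_real_derivative ln x + 1) (at x)"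
    using x by (auto intro!: derivative_eq_intros)
  then show ?thesis
    by (rule has_field_derivative_transform_within_open[of _ _ _ "{0<..}"]) (use x in \<open>auto simp: xlnx_def\<close>)
qed

lemma Ccost_has_integral: "(Ccost has_integral 0) {0..1}"
proof -
  \<comment> \<open>Twice the primitive x^2/2 ln x - x^2/4 of x ln x, plus its reflection at 1/2;
    writing it with \<open>xlnx\<close> makes it continuous at both endpoints.\<close>
  let ?F = "\<lambda>x. x + x * xlnx x - x\<^sup>2 / 2 - ((1 - x) * xlnx (1 - x) - (1 - x)\<^sup>2 / 2)"
  have "(Ccost has_integral ?F 1 - ?F 0) {0..1}"
  proof (rule fundamental_theorem_of_calculus_interior)
    show "continuous_on {0..1} ?F"
      by (intro continuous_intros continuous_on_compose2[OF continuous_on_xlnx]) auto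
    fix x :: real assume x: "x \<in> {0<..<1}"
    have 1: "(xlnx has_real_derivative ln x + 1) (at x)"
      using x by (intro xlnx_has_derivative) auto
    have 2: "((\<lambda>x. xlnx (1 - x)) has_real_derivative (ln (1 - x) + 1) * (0 - 1)) (at x)"
      using x by (intro DERIV_chain2[OF xlnx_has_derivative] derivative_intros) auto
    have "(?F has_real_derivative 1 + (xlnx x + x * (ln x + 1)) - x
       - (- xlnx (1 - x) - (1 - x) * (ln (1 - x) + 1) + (1 - x))) (at x)"
      by (auto intro!: derivative_eq_intros 1 2 simp: field_simps)
    also have "1 + (xlnx x + x * (ln x + 1)) - x - (- xlnx (1 - x) - (1 - x) * (ln (1 - x) + 1) + (1 - x))
       = Ccost x"
      using x by (simp add: Ccost_def xlnx_def algebra_simps)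
    finally have "(?F has_real_derivative Ccost x) (at x)" .
    then show "(?F has_vector_derivative Ccost x) (at x)"
      by (simp add: has_real_derivative_iff_has_vector_derivative)
  qed simp
  then show ?thesis by simp
qed

lemma poly2_has_integral:
  "((\<lambda>x. a + b * x + c * x\<^sup>2) has_integral (a + b / 2 + c / 3)) {0..1::real}"
proof -
  have "((\<lambda>x. a + b * x + c * x\<^sup>2) has_integral (a * 1 + b * 1\<^sup>2 / 2 + c * 1 ^ 3 / 3) - (a * 0 + b * 0\<^sup>2 / 2 + c * 0 ^ 3 / 3)) {0..1::real}"
    by (rule fundamental_theorem_of_calculus)
      (auto intro!: derivative_eq_intros simp flip: has_real_derivative_iff_has_vector_derivative
        simp: power2_eq_square)
  then show ?thesis by simp
qed

lemma integral_root:
  fixes f :: "real \<Rightarrow> real"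
  assumes [measurable]: "f \<in> borel_measurable borel"
  shows "integrable Pm (\<lambda>x. f (x [])) \<longleftrightarrow> integrable unif f" "(\<integral>x. f (x []) \<partial>Pm) = integral\<^sup>L unif f"
  using integrable_distr_eq[of "coord []" Pm borel f] integral_distr[of "coord []" Pm borel f]
  by (auto simp: distr_coord)

lemma integral_Vshift:
  fixes f :: "_ \<Rightarrow> real"
  assumes v: "v \<in> Vset" and [measurable]: "f \<in> borel_measurable Pm"
  shows "(\<integral>x. f (Vshift v x) \<partial>Pm) = integral\<^sup>L Pm f"
  using integral_distr[of "Vshift v" Pm Pm f] v by (simp add: distr_Vshift)

lemma indep_root:
  fixes f :: "real \<Rightarrow> real" and G :: "_ \<Rightarrow> real"
  assumes f [measurable]: "f \<in> borel_measurable borel" and G [measurable]: "G \<in> borel_measurable (Pm \<Otimes>\<^sub>M Pm)"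
  shows "Pm.indep_var borel (\<lambda>x. f (x [])) borel (\<lambda>x. G (Vshift [1] x, Vshift [2] x))"
proof -
  let ?B = "Vset - {[]}"
  let ?Y = "\<lambda>i x. \<lambda>w\<in>Vset. x (i # w) :: real"
  have Y: "?Y i \<in> measurable (PiM ?B (\<lambda>_. borel)) Pm" if "i = 1 \<or> i = 2" for i :: nat
    using that by (intro measurable_restrict_Pm measurable_component_singleton) auto
  have "Pm.indep_var borel ((\<lambda>x. f (coord [] x)) \<circ> (\<lambda>x. restrict x {[]})) borel 
     ((\<lambda>x. G (?Y 1 x, ?Y 2 x)) \<circ> (\<lambda>x. restrict x ?B))"
    by (rule Pm.indep_var_compose[OF Pm.indep_var_restrict[OF indep_coord]])
      (use Y in \<open>auto intro!: measurable_compose[OF _ G] measurable_compose[OF _ f] measurable_Pair\<close>)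
  moreover have "(\<lambda>x. G (?Y 1 x, ?Y 2 x)) \<circ> (\<lambda>x. restrict x ?B) = (\<lambda>x. G (Vshift [1] x, Vshift [2] x))"
    by (auto simp: fun_eq_iff Vshift_def cong: restrict_cong)
  moreover have "(\<lambda>x. f (coord [] x)) \<circ> (\<lambda>x. restrict x {[]}) = (\<lambda>x. f (x []))"
    by (auto simp: fun_eq_iff)
  ultimately show ?thesis by simp
qed

section \<open>Increments of the Quicksort approximations\<close>

definition qd :: "nat \<Rightarrow> (nat list \<Rightarrow> real) \<Rightarrow> real" where
  "qd m x = qm (Suc m) x - qm m x"

lemma measurable_qd [measurable]: "qd m \<in> borel_measurable Pm"
  unfolding qd_def[abs_def] by measurable

lemma qd_0: "qd 0 x = Ccost (x [])"
  by (simp add: qd_def qm_Suc)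

lemma qd_Suc: "qd (Suc m) x = x [] * qd m (Vshift [1] x) + (1 - x []) * qd m (Vshift [2] x)"
  unfolding qd_def by (subst (1 2) qm_Suc) (simp add: algebra_simps)

text \<open>The root toll has cancelled in \<open>qd_Suc\<close>, leaving a convex combination of
  the subtrees, so the bound on the toll passes from one generation to the next. It provides the
  integrability of all products below.\<close>

lemma abs_qd_le_1: "generic_tree x \<Longrightarrow> \<bar>qd m x\<bar> \<le> 1"
proof (induction m arbitrary: x)
  case 0
  then show ?case using generic_tree_Nil[OF 0] by (auto simp: qd_0 intro!: abs_Ccost_le)
next
  case (Suc m)
  let ?u = "x []" and ?a = "qd m (Vshift [1] x)" and ?b = "qd m (Vshift [2] x)"
  have u: "0 < ?u" "?u < 1" using generic_tree_Nil[OF Suc.prems] by auto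
  have ab: "\<bar>?a\<bar> \<le> 1" "\<bar>?b\<bar> \<le> 1"
    by (intro Suc.IH generic_tree_Vshift[OF Suc.prems]; simp)+
  have "\<bar>qd (Suc m) x\<bar> \<le> ?u * \<bar>?a\<bar> + (1 - ?u) * \<bar>?b\<bar>"
    using u abs_triangle_ineq[of "?u * ?a" "(1 - ?u) * ?b"] by (simp add: qd_Suc abs_mult)
  also have "\<dots> \<le> ?u * 1 + (1 - ?u) * 1"
    using u ab by (intro add_mono mult_left_mono) auto
  finally show ?case by simp
qed

lemma integrable_Pm_bounded:
  fixes f :: "_ \<Rightarrow> real"
  assumes "f \<in> borel_measurable Pm" "\<And>x. generic_tree x \<Longrightarrow> \<bar>f x\<bar> \<le> B"
  shows "integrable Pm f"
  using assms AE_generic_tree by (intro Pm.integrable_const_bound[of _ B]) (auto elim!: eventually_mono)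

lemma abs_mult_le_1: "\<bar>a\<bar> \<le> 1 \<Longrightarrow> \<bar>b\<bar> \<le> 1 \<Longrightarrow> \<bar>a * b\<bar> \<le> (1::real)"
  by (simp add: abs_mult mult_le_one)

text \<open>A signed counterpart of \<open>nn_integral_root_shifts\<close>: the cross term of the
  second moment vanishes by cancellation, which nonnegative integrals cannot express.\<close>

lemma integral_qd_product:
  fixes f :: "real \<Rightarrow> real" and g h :: "_ \<Rightarrow> real"
  assumes [measurable]: "f \<in> borel_measurable borel" "g \<in> borel_measurable Pm" "h \<in> borel_measurable Pm"
    and f: "\<And>u. 0 < u \<Longrightarrow> u < 1 \<Longrightarrow> \<bar>f u\<bar> \<le> 1"
    and g: "\<And>x. generic_tree x \<Longrightarrow> \<bar>g x\<bar> \<le> 1"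
    and h: "\<And>x. generic_tree x \<Longrightarrow> \<bar>h x\<bar> \<le> 1"
  shows "integrable Pm (\<lambda>x. f (x []) * (g (Vshift [1] x) * h (Vshift [2] x)))"
    and "(\<integral>x. f (x []) * (g (Vshift [1] x) * h (Vshift [2] x)) \<partial>Pm) = integral\<^sup>L unif f * (integral\<^sup>L Pm g * integral\<^sup>L Pm h)"
proof -
  have gs: "\<bar>g (Vshift [i] x)\<bar> \<le> 1" "\<bar>h (Vshift [i] x)\<bar> \<le> 1" if "generic_tree x" "i = 1 \<or> i = 2" for x i
    using that by (intro g h generic_tree_Vshift; auto)+
  have ms [measurable]: "Vshift [1] \<in> measurable Pm Pm" "Vshift [2] \<in> measurable Pm Pm"
    by (intro measurable_Vshift; simp)+
  have ir: "integrable Pm (\<lambda>x. f (x []))"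
    using f generic_tree_Nil by (intro integrable_Pm_bounded[where B=1]) auto
  have ig: "integrable Pm (\<lambda>x. g (Vshift [1] x))" and ih: "integrable Pm (\<lambda>x. h (Vshift [2] x))"
    using gs by (intro integrable_Pm_bounded[where B=1]; simp)+
  have igh: "integrable Pm (\<lambda>x. g (Vshift [1] x) * h (Vshift [2] x))"
    using gs by (intro integrable_Pm_bounded[where B=1] abs_mult_le_1; simp)+
  show "integrable Pm (\<lambda>x. f (x []) * (g (Vshift [1] x) * h (Vshift [2] x)))"
    using gs f generic_tree_Nil by (intro integrable_Pm_bounded[where B=1] abs_mult_le_1; simp)+
  have i1: "Pm.indep_var borel (\<lambda>x. f (x [])) borel (\<lambda>x. g (Vshift [1] x) * h (Vshift [2] x))"
    using indep_root[of f "\<lambda>p. g (fst p) * h (snd p)"] by simp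
  have i2: "Pm.indep_var borel (\<lambda>x. g (Vshift [1] x)) borel (\<lambda>x. h (Vshift [2] x))"
    using Pm.indep_var_compose[OF indep_shifts, of g borel h borel] by (simp add: o_def)
  show "(\<integral>x. f (x []) * (g (Vshift [1] x) * h (Vshift [2] x)) \<partial>Pm) = integral\<^sup>L unif f * (integral\<^sup>L Pm g * integral\<^sup>L Pm h)"
    using Pm.indep_var_lebesgue_integral[OF i1 ir igh] Pm.indep_var_lebesgue_integral[OF i2 ig ih]
    by (simp add: integral_root integral_Vshift)
qed

lemma integral_qd: "integral\<^sup>L Pm (qd m) = 0"
proof (induction m)
  case 0
  then show ?case
    unfolding qd_0[abs_def] integral_root(2)[OF Ccost_measurable]
    by (rule unif_integral(2)[OF Ccost_measurable continuous_on_Ccost Ccost_has_integral])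
next
  case (Suc m)
  \<comment> \<open>The factors 1 stand for the absent subtree, to match
    \<open>integral_qd_product\<close>.\<close>
  have "integral\<^sup>L Pm (qd (Suc m)) = (\<integral>x. x [] * (qd m (Vshift [1] x) * 1) + (1 - x []) * (1 * qd m (Vshift [2] x)) \<partial>Pm)"
    by (simp add: qd_Suc[abs_def])
  also have "\<dots> = (\<integral>x. x [] * (qd m (Vshift [1] x) * 1) \<partial>Pm) + (\<integral>x. (1 - x []) * (1 * qd m (Vshift [2] x)) \<partial>Pm)"
    by (intro Bochner_Integration.integral_add integral_qd_product(1) abs_qd_le_1) auto
  also have "(\<integral>x. x [] * (qd m (Vshift [1] x) * 1) \<partial>Pm) = integral\<^sup>L unif (\<lambda>u. u) * (integral\<^sup>L Pm (qd m) * integral\<^sup>L Pm (\<lambda>x. 1))"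
    by (intro integral_qd_product(2) abs_qd_le_1) auto
  also have "(\<integral>x. (1 - x []) * (1 * qd m (Vshift [2] x)) \<partial>Pm) = integral\<^sup>L unif (\<lambda>u. 1 - u) * (integral\<^sup>L Pm (\<lambda>x. 1) * integral\<^sup>L Pm (qd m))"
    by (intro integral_qd_product(2) abs_qd_le_1) auto
  finally show ?case by (simp add: Suc)
qed

text \<open>The factor is E u^2 + E (1 - u)^2 = 1/3 + 1/3. The cross term is 0 because the
  increments in the two subtrees are independent and centred.\<close>

lemma integral_qd_square: "integral\<^sup>L Pm (\<lambda>x. (qd m x)\<^sup>2) \<le> (2/3) ^ m"
proof (induction m)
  case 0
  have "integral\<^sup>L Pm (\<lambda>x. (qd 0 x)\<^sup>2) \<le> integral\<^sup>L Pm (\<lambda>x. 1)"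
    using AE_generic_tree abs_qd_le_1[of _ 0]
    by (intro integral_mono_AE integrable_Pm_bounded[of _ 1]) (auto simp: abs_square_le_1 elim!: eventually_mono)
  then show ?case by (simp add: Pm.prob_space)
next
  case (Suc m)
  have b: "\<bar>(qd m x)\<^sup>2\<bar> \<le> 1" if "generic_tree x" for x
    using abs_qd_le_1[OF that, of m] by (simp add: abs_square_le_1)
  have c: "\<bar>u\<^sup>2\<bar> \<le> 1" "\<bar>(1 - u)\<^sup>2\<bar> \<le> 1" "\<bar>u * (1 - u)\<bar> \<le> 1" if "0 < u" "u < 1" for u :: real
    using that by (auto simp: abs_square_le_1 abs_mult mult_le_one)
  let ?e = "integral\<^sup>L Pm (\<lambda>x. (qd m x)\<^sup>2)"
  let ?a = "\<lambda>x. (x [])\<^sup>2 * ((qd m (Vshift [1] x))\<^sup>2 * 1)"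
  let ?b = "\<lambda>x. (1 - x [])\<^sup>2 * (1 * (qd m (Vshift [2] x))\<^sup>2)"
  let ?c = "\<lambda>x. (x [] * (1 - x [])) * (qd m (Vshift [1] x) * qd m (Vshift [2] x))"
  have int: "integrable Pm ?a" "integrable Pm ?b" "integrable Pm ?c"
    using c b by (intro integral_qd_product(1)[where f="\<lambda>u. u\<^sup>2" and g="\<lambda>x. (qd m x)\<^sup>2"]
         integral_qd_product(1)[where f="\<lambda>u. (1 - u)\<^sup>2" and h="\<lambda>x. (qd m x)\<^sup>2"]
        integral_qd_product(1)[where f="\<lambda>u. u * (1 - u)"] abs_qd_le_1; simp)+
  have "integral\<^sup>L Pm (\<lambda>x. (qd (Suc m) x)\<^sup>2) = integral\<^sup>L Pm (\<lambda>x. ?a x + ?b x + 2 * ?c x)"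
    by (intro Bochner_Integration.integral_cong refl) (simp add: qd_Suc power2_eq_square algebra_simps)
  also have "\<dots> = integral\<^sup>L Pm ?a + integral\<^sup>L Pm ?b + 2 * integral\<^sup>L Pm ?c"
    using int by simp
  also have "integral\<^sup>L Pm ?a = integral\<^sup>L unif (\<lambda>u. u\<^sup>2) * (?e * integral\<^sup>L Pm (\<lambda>x. 1))"
    using c b by (intro integral_qd_product(2)) auto
  also have "integral\<^sup>L Pm ?b = integral\<^sup>L unif (\<lambda>u. (1 - u)\<^sup>2) * (integral\<^sup>L Pm (\<lambda>x. 1) * ?e)"
    using c b by (intro integral_qd_product(2)) auto
  also have "integral\<^sup>L Pm ?c = integral\<^sup>L unif (\<lambda>u. u * (1 - u)) * (integral\<^sup>L Pm (qd m) * integral\<^sup>L Pm (qd m))"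
    using c by (intro integral_qd_product(2) abs_qd_le_1) auto
  also have "integral\<^sup>L unif (\<lambda>u. u\<^sup>2) = 1 / 3"
    using poly2_has_integral[of 0 0 1] by (intro unif_integral) (auto intro!: continuous_intros)
  also have "integral\<^sup>L unif (\<lambda>u. (1 - u)\<^sup>2) = 1 / 3"
    using poly2_has_integral[of 1 "-2" 1]
    by (intro unif_integral) (auto intro!: continuous_intros simp: power2_eq_square algebra_simps)
  finally show ?case
    using Suc by (simp add: integral_qd Pm.prob_space)
qed

lemma AE_qm_tendsto: "AE x in Pm. (\<lambda>m. qm m x) \<longlonglongrightarrow> ql x"
proof -
  have "AE x in Pm. summable (\<lambda>m. \<bar>qd m x\<bar>)"
  proof (rule Pm.AE_summable_of_L2_geometric[where K=1])
    fix m
    have "integrable Pm (\<lambda>x. (qd m x)\<^sup>2)"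
      using abs_qd_le_1[of _ m] by (intro integrable_Pm_bounded[of _ 1]) (auto simp: abs_square_le_1)
    then have "(\<integral>\<^sup>+x. ennreal ((qd m x)\<^sup>2) \<partial>Pm) = ennreal (integral\<^sup>L Pm (\<lambda>x. (qd m x)\<^sup>2))"
      by (intro nn_integral_eq_integral) auto
    then show "(\<integral>\<^sup>+x. ennreal (\<bar>qd m x\<bar>\<^sup>2) \<partial>Pm) \<le> ennreal (1 * (2/3) ^ m)"
      using integral_qd_square[of m] by (simp add: ennreal_leI)
  qed auto
  then show ?thesis
  proof eventually_elim
    case (elim x)
    then have "summable (\<lambda>m. qd m x)" by (rule summable_rabs_cancel)
    moreover have "(\<Sum>k<m. qd k x) = qm m x" for m
      unfolding qd_def by (subst sum_lessThan_telescope) simp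
    ultimately have "convergent (\<lambda>m. qm m x)"
      by (simp add: summable_iff_convergent)
    then show ?case by (simp add: ql_eq convergent_LIMSEQ_iff)
  qed
qed

subsection \<open>Exponential moments\<close>

text \<open>For negative x = -y the claim is 1 <= (1 - y + y^2) exp y. Replacing exp y by its
  quadratic Taylor polynomial already gives 1 + y^2/2 + y^3/2 + y^4/2.\<close>

lemma exp_le_quadratic: "\<bar>x\<bar> \<le> 1 \<Longrightarrow> exp x \<le> 1 + x + x\<^sup>2" for x :: real
proof (cases "x \<ge> 0")
  case False
  assume "\<bar>x\<bar> \<le> 1"
  define y where "y = - x"
  have y: "y \<ge> 0" using False by (simp add: y_def)
  have "1 \<le> (1 - y + y\<^sup>2) * (1 + y + y\<^sup>2 / 2)"
  proof -
    have "(1 - y + y\<^sup>2) * (1 + y + y\<^sup>2 / 2) = 1 + y\<^sup>2 / 2 + y ^ 3 / 2 + y ^ 4 / 2"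
      by (simp add: power2_eq_square power3_eq_cube power4_eq_xxxx field_simps)
    then show ?thesis using y by simp
  qed
  also have "\<dots> \<le> (1 - y + y\<^sup>2) * exp y"
  proof (rule mult_left_mono)
    show "1 + y + y\<^sup>2 / 2 \<le> exp y" using exp_lower_Taylor_quadratic[OF y] .
    have "1 - y + y\<^sup>2 = (y - 1/2)\<^sup>2 + 3/4" by (simp add: power2_eq_square algebra_simps)
    then show "0 \<le> 1 - y + y\<^sup>2" by simp
  qed
  finally have "exp (- y) \<le> 1 - y + y\<^sup>2"
    by (simp add: exp_minus field_simps)
  then show ?thesis by (simp add: y_def)
qed (auto intro: exp_bound)

text \<open>The quadratic term \<open>- 24 l\<^sup>2 u (1 - u)\<close>, of mean \<open>- 4 l\<^sup>2\<close>, absorbs the second moment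
  of the toll function; this is what makes the bound \<open>exp (12 l\<^sup>2)\<close> reproduce itself.\<close>
lemma nn_integral_exp_toll_le:
  assumes l: "\<bar>l\<bar> \<le> 1/6"
  shows "(\<integral>\<^sup>+u. ennreal (exp (l * Ccost u + 12 * (l * u)\<^sup>2 + 12 * (l * (1 - u))\<^sup>2)) \<partial>unif) \<le> ennreal (exp (12 * l\<^sup>2))"
proof -
  \<comment> \<open>Since u^2 + (1 - u)^2 = 1 - 2 u (1 - u), the exponent is 12 l^2 + X with X = l
    C(u) - 24 l^2 u (1 - u). The majorant of exp X is 1 + X + 4 l^2, whose mean is exactly
    1.\<close>
  let ?g = "\<lambda>u. 1 + l * Ccost u - 24 * l\<^sup>2 * u * (1 - u) + 4 * l\<^sup>2"
  have l2: "l\<^sup>2 \<le> 1 / 36"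
    using power_mono[OF l, of 2] by (simp add: power2_eq_square)
  have pt: "exp (l * Ccost u + 12 * (l * u)\<^sup>2 + 12 * (l * (1 - u))\<^sup>2) \<le> exp (12 * l\<^sup>2) * ?g u"
    and nonneg: "?g u \<ge> 0" if u: "0 < u" "u < 1" for u
  proof -
    define p where "p = u * (1 - u)"
    have p: "0 \<le> p" "p \<le> 1/4"
    proof -
      have "1/4 - p = (u - 1/2)\<^sup>2" by (simp add: p_def power2_eq_square algebra_simps)
      then show "p \<le> 1/4" by (metis diff_ge_0_iff_ge zero_le_power2)
    qed (use u in \<open>simp add: p_def\<close>)
    define X where "X = l * Ccost u - 24 * l\<^sup>2 * p"
    have C: "\<bar>Ccost u\<bar> \<le> 1" using u by (intro abs_Ccost_le) auto
    have lC: "\<bar>l * Ccost u\<bar> \<le> \<bar>l\<bar>"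
      using mult_left_mono[OF C, of "\<bar>l\<bar>"] by (simp add: abs_mult)
    have lp: "l\<^sup>2 * p \<le> l\<^sup>2 * (1/4)" by (rule mult_left_mono[OF p(2)]) simp
    have lp0: "0 \<le> l\<^sup>2 * p" using p by simp
    have X1: "\<bar>X\<bar> \<le> 1"
      using lC l lp lp0 l2 unfolding X_def by linarith
    \<comment> \<open>Both squares turn out to be at most l^2; for the second, 36 l^4 <= l^2 is
      exactly the condition that the absolute value of l is at most 1/6.\<close>
    have "X\<^sup>2 \<le> 2 * (l * Ccost u)\<^sup>2 + 2 * (24 * (l\<^sup>2 * p))\<^sup>2"
      unfolding X_def using sum_squares_bound[of "l * Ccost u" "- (24 * (l\<^sup>2 * p))"]
      by (simp add: power2_eq_square algebra_simps)
    also have "(l * Ccost u)\<^sup>2 \<le> l\<^sup>2"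
      using power_mono[OF lC, of 2] by simp
    also have "(24 * (l\<^sup>2 * p))\<^sup>2 \<le> (24 * (l\<^sup>2 * (1/4)))\<^sup>2"
      using lp lp0 by (intro power_mono) (simp_all add: mult.commute)
    also have "(24 * (l\<^sup>2 * (1/4)))\<^sup>2 = 36 * l\<^sup>2 * l\<^sup>2"
      by (simp add: power2_eq_square)
    also have "\<dots> \<le> 36 * (1/36) * l\<^sup>2"
      using l2 by (intro mult_right_mono mult_left_mono) auto
    finally have "X\<^sup>2 \<le> 4 * l\<^sup>2" by simp
    with exp_le_quadratic[OF X1] have e: "exp X \<le> ?g u"
      by (simp add: X_def p_def mult.assoc)
    then show "?g u \<ge> 0" using exp_ge_zero[of X] by linarith
    have "l * Ccost u + 12 * (l * u)\<^sup>2 + 12 * (l * (1 - u))\<^sup>2 = 12 * l\<^sup>2 + X"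
      by (simp add: X_def p_def power2_eq_square algebra_simps)
    then show "exp (l * Ccost u + 12 * (l * u)\<^sup>2 + 12 * (l * (1 - u))\<^sup>2) \<le> exp (12 * l\<^sup>2) * ?g u"
      using e by (simp add: exp_add)
  qed
  have gi: "(?g has_integral 1) {0..1}"
  proof -
    have "((\<lambda>u. l * Ccost u + ((1 + 4 * l\<^sup>2) + (- 24 * l\<^sup>2) * u + (24 * l\<^sup>2) * u\<^sup>2)) has_integral
       (l * 0 + ((1 + 4 * l\<^sup>2) + (- 24 * l\<^sup>2) / 2 + (24 * l\<^sup>2) / 3))) {0..1}"
      by (intro has_integral_add has_integral_mult_right Ccost_has_integral poly2_has_integral)
    then show ?thesis by (simp add: algebra_simps power2_eq_square)
  qed
  have cg: "continuous_on {0..1} ?g"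
    by (intro continuous_intros continuous_on_Ccost)
  have mg: "?g \<in> borel_measurable borel" by measurable
  have "(\<integral>\<^sup>+u. ennreal (exp (l * Ccost u + 12 * (l * u)\<^sup>2 + 12 * (l * (1 - u))\<^sup>2)) \<partial>unif)
    \<le> (\<integral>\<^sup>+u. ennreal (exp (12 * l\<^sup>2) * ?g u) \<partial>unif)"
  proof (rule nn_integral_mono_AE, use AE_unif in eventually_elim)
    case (elim u)
    then show ?case using pt by (intro ennreal_leI) auto
  qed
  also have "\<dots> = ennreal (\<integral>u. exp (12 * l\<^sup>2) * ?g u \<partial>unif)"
  proof (rule nn_integral_eq_integral)
    show "integrable unif (\<lambda>u. exp (12 * l\<^sup>2) * ?g u)"
      by (intro integrable_mult_right unif_integral(1)[OF mg cg gi])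
    show "AE u in unif. 0 \<le> exp (12 * l\<^sup>2) * ?g u"
      using AE_unif by eventually_elim (intro mult_nonneg_nonneg nonneg; simp)
  qed
  also have "\<dots> = ennreal (exp (12 * l\<^sup>2))"
    using unif_integral[OF mg cg gi] by simp
  finally show ?thesis .
qed

text \<open>The induction runs over all l at once: given the root label u, the subtrees are weighted
  by l u and l (1 - u), which stay in the admissible range.\<close>

lemma exp_moment_qm: "\<bar>l\<bar> \<le> 1/6 \<Longrightarrow> (\<integral>\<^sup>+x. ennreal (exp (l * qm m x)) \<partial>Pm) \<le> ennreal (exp (12 * l\<^sup>2))"
proof (induction m arbitrary: l)
  case 0
  then show ?case by (simp add: Pm.emeasure_space_1)
next
  case (Suc m)
  let ?F = "\<lambda>u y z. ennreal (exp (l * Ccost u)) * (ennreal (exp (l * u * qm m y)) * ennreal (exp (l * (1 - u) * qm m z)))"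
  have "(\<integral>\<^sup>+x. ennreal (exp (l * qm (Suc m) x)) \<partial>Pm) = (\<integral>\<^sup>+x. ?F (x []) (Vshift [1] x) (Vshift [2] x) \<partial>Pm)"
    by (intro nn_integral_cong) (simp add: qm_Suc exp_add algebra_simps flip: ennreal_mult exp_add)
  also have "\<dots> = (\<integral>\<^sup>+u. \<integral>\<^sup>+y. \<integral>\<^sup>+z. ?F u y z \<partial>Pm \<partial>Pm \<partial>unif)"
    by (rule nn_integral_root_shifts) measurable
  also have "\<dots> = (\<integral>\<^sup>+u. ennreal (exp (l * Ccost u)) * ((\<integral>\<^sup>+y. ennreal (exp (l * u * qm m y)) \<partial>Pm) *
       (\<integral>\<^sup>+z. ennreal (exp (l * (1 - u) * qm m z)) \<partial>Pm)) \<partial>unif)"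
    by (simp add: nn_integral_cmult nn_integral_multc)
  also have "\<dots> \<le> (\<integral>\<^sup>+u. ennreal (exp (l * Ccost u + 12 * (l * u)\<^sup>2 + 12 * (l * (1 - u))\<^sup>2)) \<partial>unif)"
  proof (rule nn_integral_mono_AE, use AE_unif in eventually_elim)
    case (elim u)
    have 1: "\<bar>l * u\<bar> \<le> 1/6" "\<bar>l * (1 - u)\<bar> \<le> 1/6"
      using elim Suc.prems mult_mono[of "\<bar>l\<bar>" "1/6" u 1] mult_mono[of "\<bar>l\<bar>" "1/6" "1 - u" 1]
      by (auto simp: abs_mult)
    have "ennreal (exp (l * Ccost u)) * ((\<integral>\<^sup>+y. ennreal (exp (l * u * qm m y)) \<partial>Pm) *
       (\<integral>\<^sup>+z. ennreal (exp (l * (1 - u) * qm m z)) \<partial>Pm))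
      \<le> ennreal (exp (l * Ccost u)) * (ennreal (exp (12 * (l * u)\<^sup>2)) * ennreal (exp (12 * (l * (1 - u))\<^sup>2)))"
      using Suc.IH[OF 1(1)] Suc.IH[OF 1(2)] by (intro mult_mono) auto
    then show ?case by (simp add: exp_add mult.assoc flip: ennreal_mult)
  qed
  also have "\<dots> \<le> ennreal (exp (12 * l\<^sup>2))"
    by (rule nn_integral_exp_toll_le) fact
  finally show ?case .
qed

text \<open>Fatou's lemma, as the bound for the approximations is uniform in m.\<close>

lemma exp_moment_ql:
  assumes "\<bar>l\<bar> \<le> 1/6"
  shows "(\<integral>\<^sup>+x. ennreal (exp (l * ql x)) \<partial>Pm) \<le> ennreal (exp (12 * l\<^sup>2))"
proof -
  have "(\<integral>\<^sup>+x. ennreal (exp (l * ql x)) \<partial>Pm) = (\<integral>\<^sup>+x. liminf (\<lambda>m. ennreal (exp (l * qm m x))) \<partial>Pm)"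
  proof (rule nn_integral_cong_AE, use AE_qm_tendsto in eventually_elim)
    case (elim x)
    then have "(\<lambda>m. ennreal (exp (l * qm m x))) \<longlonglongrightarrow> ennreal (exp (l * ql x))"
      by (intro tendsto_intros)
    then show ?case by (rule lim_imp_Liminf[OF sequentially_bot, symmetric])
  qed
  also have "\<dots> \<le> liminf (\<lambda>m. \<integral>\<^sup>+x. ennreal (exp (l * qm m x)) \<partial>Pm)"
    by (intro nn_integral_liminf) measurable
  also have "\<dots> \<le> liminf (\<lambda>m. ennreal (exp (12 * l\<^sup>2)))"
    using exp_moment_qm[OF assms] by (intro Liminf_mono) auto
  finally show ?thesis by (simp add: Liminf_const)
qed

lemma integrable_ql_powr:
  assumes p: "p > 0"
  shows "integrable Pm (\<lambda>x. \<bar>ql x\<bar> powr p)"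
proof (rule integrableI_bounded)
  have pt: "\<bar>y\<bar> powr p \<le> (6 * p) powr p * (exp (1/6 * y) + exp (-1/6 * y))" for y :: real
  proof -
    \<comment> \<open>Scaled so that z <= exp z, raised to the power p, produces the exponential
      rate 1/6, the largest one that \<open>exp_moment_ql\<close> covers.\<close>
    define z where "z = \<bar>y\<bar> / (6 * p)"
    have z: "z \<ge> 0" using p by (simp add: z_def)
    have "z powr p \<le> exp z powr p"
      using z p order_trans[OF _ exp_ge_add_one_self, of z z] by (intro powr_mono2) auto
    also have "exp z powr p = exp (\<bar>y\<bar> / 6)"
      using p by (simp add: powr_def z_def)
    also have "\<dots> \<le> exp (1/6 * y) + exp (-1/6 * y)"
      by (cases "y \<ge> 0") (auto simp: add_increasing add_increasing2)
    finally have "(6 * p) powr p * z powr p \<le> (6 * p) powr p * (exp (1/6 * y) + exp (-1/6 * y))"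
      by (intro mult_left_mono) auto
    moreover have "(6 * p) powr p * z powr p = \<bar>y\<bar> powr p"
      using p z by (simp add: z_def flip: powr_mult)
    ultimately show ?thesis by simp
  qed
  have "(\<integral>\<^sup>+x. ennreal (norm (\<bar>ql x\<bar> powr p)) \<partial>Pm)
    \<le> (\<integral>\<^sup>+x. ennreal ((6 * p) powr p) * (ennreal (exp (1/6 * ql x)) + ennreal (exp (-1/6 * ql x))) \<partial>Pm)"
    by (intro nn_integral_mono) (use pt in \<open>simp flip: ennreal_plus ennreal_mult\<close>)
  also have "\<dots> = ennreal ((6 * p) powr p) * ((\<integral>\<^sup>+x. ennreal (exp (1/6 * ql x)) \<partial>Pm) + (\<integral>\<^sup>+x. ennreal (exp (-1/6 * ql x)) \<partial>Pm))"
    by (subst nn_integral_cmult, measurable, subst nn_integral_add) auto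
  also have "\<dots> \<le> ennreal ((6 * p) powr p) * (ennreal (exp (12 * (1/6)\<^sup>2)) + ennreal (exp (12 * (-1/6)\<^sup>2)))"
    by (intro mult_left_mono add_mono exp_moment_ql) auto
  also have "\<dots> < \<infinity>"
    by (simp add: ennreal_mult_less_top flip: ennreal_plus)
  finally show "(\<integral>\<^sup>+x. ennreal (norm (\<bar>ql x\<bar> powr p)) \<partial>Pm) < \<infinity>" .
qed measurable

subsection \<open>Minkowski's inequality\<close>

text \<open>Convexity, with a + b written as l (a/l) + (1 - l) (b/(1 - l)). After integration the
  choice l = A / (A + B) turns the right-hand side into (A + B) powr p.\<close>

lemma powr_add_le_weighted:
  fixes a b l p :: real
  assumes "a \<ge> 0" "b \<ge> 0" "p \<ge> 1" "0 < l" "l < 1"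
  shows "(a + b) powr p \<le> l powr (1 - p) * a powr p + (1 - l) powr (1 - p) * b powr p"
proof -
  have ge1: "1 \<le> c powr (1 - p)" if "0 < c" "c < 1" for c :: real
    using powr_mono'[of "1 - p" 0 c] that assms by simp
  have wt: "c * (x / c) powr p = c powr (1 - p) * x powr p" if "0 < c" "x \<ge> 0" for c x :: real
    using that by (simp add: powr_divide powr_diff)
  consider "a = 0" | "b = 0" | "a > 0" "b > 0" using assms by fastforce
  then show ?thesis
  proof cases
    case 1
    then show ?thesis using mult_right_mono[OF ge1[of "1 - l"], of "b powr p"] assms by simp
  next
    case 2
    then show ?thesis using mult_right_mono[OF ge1[of l], of "a powr p"] assms by simp
  next
    case 3
    have "(l * (a / l) + (1 - l) * (b / (1 - l))) powr p \<le> l * (a / l) powr p + (1 - l) * (b / (1 - l)) powr p"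
      using convex_onD[OF powr_convex[OF assms(3)], of "1 - l" "a / l" "b / (1 - l)"] assms 3
      by simp
    then show ?thesis
      using assms 3 by (simp add: wt)
  qed
qed

text \<open>Minkowski with majorants A and B in place of the norms, so that no roots of extended
  integrals occur and bounds can be fed in directly during an induction.\<close>

lemma nn_integral_powr_add_le:
  fixes f g :: "'a \<Rightarrow> real"
  assumes [measurable]: "f \<in> borel_measurable M" "g \<in> borel_measurable M"
    and nn: "\<And>x. 0 \<le> f x" "\<And>x. 0 \<le> g x" and p: "p \<ge> 1" and AB: "A \<ge> 0" "B \<ge> 0"
    and f: "(\<integral>\<^sup>+x. ennreal (f x powr p) \<partial>M) \<le> ennreal (A powr p)"
    and g: "(\<integral>\<^sup>+x. ennreal (g x powr p) \<partial>M) \<le> ennreal (B powr p)"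
  shows "(\<integral>\<^sup>+x. ennreal ((f x + g x) powr p) \<partial>M) \<le> ennreal ((A + B) powr p)"
proof -
  \<comment> \<open>Strictly larger constants keep the weight l inside (0,1) even if A or B is 0; A
    and B themselves are reached in the limit at the end.\<close>
  have pos: "(\<integral>\<^sup>+x. ennreal ((f x + g x) powr p) \<partial>M) \<le> ennreal ((A' + B') powr p)"
    if gt: "A' > A" "B' > B" for A' B'
  proof -
    have 0: "A' > 0" "B' > 0" using gt AB by auto
    define l where "l = A' / (A' + B')"
    have l: "0 < l" "l < 1" using 0 by (auto simp: l_def)
    have l1: "1 - l = B' / (A' + B')" using 0 by (simp add: l_def field_simps)
    have "(\<integral>\<^sup>+x. ennreal ((f x + g x) powr p) \<partial>M)
      \<le> (\<integral>\<^sup>+x. ennreal (l powr (1 - p)) * ennreal (f x powr p) + ennreal ((1 - l) powr (1 - p)) * ennreal (g x powr p) \<partial>M)"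
      using nn p l by (intro nn_integral_mono) (simp add: powr_add_le_weighted flip: ennreal_plus ennreal_mult)
    also have "\<dots> = ennreal (l powr (1 - p)) * (\<integral>\<^sup>+x. ennreal (f x powr p) \<partial>M)
       + ennreal ((1 - l) powr (1 - p)) * (\<integral>\<^sup>+x. ennreal (g x powr p) \<partial>M)"
      by (subst nn_integral_add) (auto simp: nn_integral_cmult)
    also have "\<dots> \<le> ennreal (l powr (1 - p)) * ennreal (A' powr p) + ennreal ((1 - l) powr (1 - p)) * ennreal (B' powr p)"
      using gt AB p by (intro add_mono mult_left_mono order_trans[OF f] order_trans[OF g] ennreal_leI powr_mono2) auto
    also have "\<dots> = ennreal (l powr (1 - p) * A' powr p + (1 - l) powr (1 - p) * B' powr p)"
      by (simp flip: ennreal_plus ennreal_mult)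
    also have "l powr (1 - p) * A' powr p + (1 - l) powr (1 - p) * B' powr p = (A' + B') powr p"
    proof -
      have "(c / (A' + B')) powr (1 - p) * c powr p = (A' + B') powr (p - 1) * c" if "c > 0" for c
      proof -
        have "(c / (A' + B')) powr (1 - p) * c powr p = (c powr (1 - p) * c powr p) * inverse ((A' + B') powr (1 - p))"
          using that 0 by (subst powr_divide) (auto simp: divide_inverse)
        also have "c powr (1 - p) * c powr p = c"
          using that by (simp flip: powr_add)
        also have "inverse ((A' + B') powr (1 - p)) = (A' + B') powr (p - 1)"
          by (simp flip: powr_minus)
        finally show ?thesis by (simp add: mult.commute)
      qed
      then have "l powr (1 - p) * A' powr p + (1 - l) powr (1 - p) * B' powr p = (A' + B') powr (p - 1) * (A' + B')"
        unfolding l1 unfolding l_def using 0 by (simp add: distrib_left)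
      then show ?thesis using 0 by (simp add: powr_diff)
    qed
    finally show ?thesis .
  qed
  have "((\<lambda>e. ennreal ((A + e + (B + e)) powr p)) \<longlongrightarrow> ennreal ((A + 0 + (B + 0)) powr p)) (at_right 0)"
  proof (intro tendsto_ennrealI tendsto_powr2 tendsto_intros)
    show "\<forall>\<^sub>F e in at_right 0. 0 \<le> A + e + (B + e)"
      using AB by (auto simp: eventually_at_right_field intro!: exI[of _ 1])
  qed (use p in auto)
  moreover have "\<forall>\<^sub>F e in at_right 0. (\<integral>\<^sup>+x. ennreal ((f x + g x) powr p) \<partial>M) \<le> ennreal ((A + e + (B + e)) powr p)"
    using eventually_at_right_greater[OF order_refl]
    by eventually_elim (intro pos; simp)
  ultimately show ?thesis
    by (auto intro: tendsto_lowerbound[of _ _ "at_right (0::real)"])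
qed

subsection \<open>Contraction\<close>

lemma nn_integral_unif_powr:
  assumes p: "p > 0"
  shows "(\<integral>\<^sup>+u. ennreal (\<bar>u\<bar> powr p) \<partial>unif) = ennreal (1 / (p + 1))"
    and "(\<integral>\<^sup>+u. ennreal (\<bar>1 - u\<bar> powr p) \<partial>unif) = ennreal (1 / (p + 1))"
proof -
  have "((\<lambda>u. \<bar>u\<bar> powr p) has_integral 1 powr (p + 1) / (p + 1) - 0 powr (p + 1) / (p + 1)) {0..1}"
  proof (rule fundamental_theorem_of_calculus_interior)
    show "continuous_on {0..1} (\<lambda>u. u powr (p + 1) / (p + 1))"
      using p by (intro continuous_intros continuous_on_powr') auto
    show "((\<lambda>u. u powr (p + 1) / (p + 1)) has_vector_derivative \<bar>u\<bar> powr p) (at u)" if "u \<in> {0<..<1}" for u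
      using that p by (auto intro!: derivative_eq_intros simp flip: has_real_derivative_iff_has_vector_derivative)
  qed simp
  then have i: "((\<lambda>u. \<bar>u\<bar> powr p) has_integral 1 / (p + 1)) {0..1}"
    using p by simp
  have c: "continuous_on {0..1} (\<lambda>u::real. \<bar>u\<bar> powr p)"
    using p by (intro continuous_on_powr' continuous_intros) auto
  have ii: "integrable unif (\<lambda>u. \<bar>u\<bar> powr p)" "integral\<^sup>L unif (\<lambda>u. \<bar>u\<bar> powr p) = 1 / (p + 1)"
    using i c by (intro unif_integral; simp)+
  then show "(\<integral>\<^sup>+u. ennreal (\<bar>u\<bar> powr p) \<partial>unif) = ennreal (1 / (p + 1))"
    by (subst nn_integral_eq_integral) auto
  have "((\<lambda>u. \<bar>1 - u\<bar> powr p) has_integral - ((1 - 1) powr (p + 1) / (p + 1)) - - ((1 - 0) powr (p + 1) / (p + 1))) {0..1}"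
  proof (rule fundamental_theorem_of_calculus_interior)
    show "continuous_on {0..1} (\<lambda>u. - ((1 - u) powr (p + 1) / (p + 1)))"
      using p by (intro continuous_intros continuous_on_powr') auto
    show "((\<lambda>u. - ((1 - u) powr (p + 1) / (p + 1))) has_vector_derivative \<bar>1 - u\<bar> powr p) (at u)" if "u \<in> {0<..<1}" for u
      using that p by (auto intro!: derivative_eq_intros simp flip: has_real_derivative_iff_has_vector_derivative)
  qed simp
  then have i: "((\<lambda>u. \<bar>1 - u\<bar> powr p) has_integral 1 / (p + 1)) {0..1}"
    using p by simp
  have c: "continuous_on {0..1} (\<lambda>u::real. \<bar>1 - u\<bar> powr p)"
    using p by (intro continuous_on_powr' continuous_intros) auto
  have ii: "integrable unif (\<lambda>u. \<bar>1 - u\<bar> powr p)" "integral\<^sup>L unif (\<lambda>u. \<bar>1 - u\<bar> powr p) = 1 / (p + 1)"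
    using i c by (intro unif_integral; simp)+
  then show "(\<integral>\<^sup>+u. ennreal (\<bar>1 - u\<bar> powr p) \<partial>unif) = ennreal (1 / (p + 1))"
    by (subst nn_integral_eq_integral) auto
qed

lemma nn_integral_root_times_shift:
  assumes [measurable]: "f \<in> borel_measurable borel" "H \<in> borel_measurable Pm" and i: "i = 1 \<or> i = 2"
  shows "(\<integral>\<^sup>+x. f (x []) * H (Vshift [i] x) \<partial>Pm) = (\<integral>\<^sup>+u. f u \<partial>unif) * (\<integral>\<^sup>+x. H x \<partial>Pm)"
proof -
  have "(\<integral>\<^sup>+u. f u * (\<integral>\<^sup>+x. H x \<partial>Pm) \<partial>unif) = (\<integral>\<^sup>+u. f u \<partial>unif) * (\<integral>\<^sup>+x. H x \<partial>Pm)"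
    by (rule nn_integral_multc) (simp add: measurable_cong_sets[OF sets_unif refl])
  then show ?thesis
    using i nn_integral_root_shifts[of "\<lambda>u y z. f u * H y"] nn_integral_root_shifts[of "\<lambda>u y z. f u * H z"]
    by (auto simp: nn_integral_cmult Pm.emeasure_space_1)
qed

text \<open>The two branches act on disjoint parts of the interval, hence the maximum instead of a sum:
  this is what makes the map a contraction in \<open>L\<^sub>p\<close> for every \<open>p > 1\<close>.\<close>
lemma nn_integral_max_branches_le:
  fixes H :: "(nat list \<Rightarrow> real) \<Rightarrow> real"
  assumes [measurable]: "H \<in> borel_measurable Pm" and H: "\<And>x. 0 \<le> H x" and p: "p > 0"
  shows "(\<integral>\<^sup>+x. ennreal (max (\<bar>x []\<bar> * H (Vshift [1] x)) (\<bar>1 - x []\<bar> * H (Vshift [2] x)) powr p) \<partial>Pm)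
    \<le> ennreal (2 / (p + 1)) * (\<integral>\<^sup>+x. ennreal (H x powr p) \<partial>Pm)"
proof -
  let ?I = "\<integral>\<^sup>+x. ennreal (H x powr p) \<partial>Pm"
  have ms [measurable]: "Vshift [1] \<in> measurable Pm Pm" "Vshift [2] \<in> measurable Pm Pm"
    by (intro measurable_Vshift; simp)+
  have "(\<integral>\<^sup>+x. ennreal (max (\<bar>x []\<bar> * H (Vshift [1] x)) (\<bar>1 - x []\<bar> * H (Vshift [2] x)) powr p) \<partial>Pm)
   \<le> (\<integral>\<^sup>+x. ennreal (\<bar>x []\<bar> powr p) * ennreal (H (Vshift [1] x) powr p) +
        ennreal (\<bar>1 - x []\<bar> powr p) * ennreal (H (Vshift [2] x) powr p) \<partial>Pm)"
  proof (rule nn_integral_mono)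
    fix x
    have "max a b powr p \<le> a powr p + b powr p" for a b :: real
      by (auto simp: max_def)
    from this[of "\<bar>x []\<bar> * H (Vshift [1] x)" "\<bar>1 - x []\<bar> * H (Vshift [2] x)"]
    show "ennreal (max (\<bar>x []\<bar> * H (Vshift [1] x)) (\<bar>1 - x []\<bar> * H (Vshift [2] x)) powr p)
      \<le> ennreal (\<bar>x []\<bar> powr p) * ennreal (H (Vshift [1] x) powr p) +
        ennreal (\<bar>1 - x []\<bar> powr p) * ennreal (H (Vshift [2] x) powr p)"
      using H by (simp add: powr_mult flip: ennreal_mult ennreal_plus)
  qed
  also have "\<dots> = (\<integral>\<^sup>+x. ennreal (\<bar>x []\<bar> powr p) * ennreal (H (Vshift [1] x) powr p) \<partial>Pm) +
     (\<integral>\<^sup>+x. ennreal (\<bar>1 - x []\<bar> powr p) * ennreal (H (Vshift [2] x) powr p) \<partial>Pm)"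
    by (intro nn_integral_add) measurable
  also have "(\<integral>\<^sup>+x. ennreal (\<bar>x []\<bar> powr p) * ennreal (H (Vshift [1] x) powr p) \<partial>Pm) = ennreal (1 / (p + 1)) * ?I"
    using nn_integral_root_times_shift[of "\<lambda>u. ennreal (\<bar>u\<bar> powr p)" "\<lambda>x. ennreal (H x powr p)" 1]
    by (simp add: nn_integral_unif_powr[OF p])
  also have "(\<integral>\<^sup>+x. ennreal (\<bar>1 - x []\<bar> powr p) * ennreal (H (Vshift [2] x) powr p) \<partial>Pm) = ennreal (1 / (p + 1)) * ?I"
    using nn_integral_root_times_shift[of "\<lambda>u. ennreal (\<bar>1 - u\<bar> powr p)" "\<lambda>x. ennreal (H x powr p)" 2]
    by (simp add: nn_integral_unif_powr[OF p])
  also have "ennreal (1 / (p + 1)) * ?I + ennreal (1 / (p + 1)) * ?I = ennreal (2 / (p + 1)) * ?I"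
    using p by (simp flip: distrib_right ennreal_plus add_divide_distrib)
  finally show ?thesis .
qed

lemma measurable_supnorm_rm [measurable]: "(\<lambda>x. supnorm (rm m x)) \<in> borel_measurable Pm"
  by (intro measurable_supnorm bcadlag_Rm measurable_rm)

text \<open>The absolute values change nothing on generic trees; they make the right-hand side
  nonnegative everywhere, as the L_p estimates require.\<close>

lemma supnorm_rm_Suc_le:
  assumes "generic_tree x"
  shows "supnorm (rm (Suc m) x) \<le>
    max (\<bar>x []\<bar> * supnorm (rm m (Vshift [1] x))) (\<bar>1 - x []\<bar> * supnorm (rm m (Vshift [2] x)))
     + (8 + \<bar>x []\<bar> * \<bar>ql (Vshift [1] x)\<bar>)"
proof -
  have u: "0 < x []" "x [] < 1" using generic_tree_Nil[OF assms] by auto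
  have "\<bar>Cfun coord [] x t\<bar> \<le> 8 + \<bar>x []\<bar> * \<bar>ql (Vshift [1] x)\<bar>" if "t \<in> {0..1}" for t
  proof -
    have "\<bar>Ccost2 t (x [])\<bar> \<le> 8"
      using u that by (intro abs_Ccost2_le) auto
    moreover have "\<bar>if x [] \<le> t then x [] * ql (Vshift [1] x) else 0\<bar> \<le> \<bar>x []\<bar> * \<bar>ql (Vshift [1] x)\<bar>"
      by (simp add: abs_mult)
    ultimately show ?thesis
      unfolding Cfun_coord by (rule order_trans[OF abs_triangle_ineq add_mono])
  qed
  then show ?thesis
    using supnorm_step_le[OF bcadlag_Rm bcadlag_Rm, of "x []" "Cfun coord [] x"
        "8 + \<bar>x []\<bar> * \<bar>ql (Vshift [1] x)\<bar>"] u
    unfolding rm_Suc[abs_def] by simp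
qed

section \<open>The uniform moment bound for the truncations\<close>

lemma kp_powr: "p > 0 \<Longrightarrow> kp p powr p = 2 / (p + 1)"
  by (simp add: kp_def powr_powr)

lemma kp_less_1: "p > 1 \<Longrightarrow> kp p < 1"
  using powr_less_mono2[of "1 / p" "2 / (p + 1)" 1] by (simp add: kp_def)

lemma kp_nonneg: "0 \<le> kp p"
  by (simp add: kp_def)

definition Rbound :: "real \<Rightarrow> real" where
  "Rbound p = (8 + 2 powr (- 1 / p) * kp p * (\<integral>x. \<bar>ql x\<bar> powr p \<partial>Pm) powr (1 / p)) / (1 - kp p)"

lemma Rbound_nonneg: "p > 1 \<Longrightarrow> 0 \<le> Rbound p"
  unfolding Rbound_def using kp_less_1[of p] kp_nonneg[of p]
  by (intro divide_nonneg_nonneg add_nonneg_nonneg mult_nonneg_nonneg) auto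

lemma nn_integral_supnorm_rm_le:
  assumes p: "p > 1"
  shows "(\<integral>\<^sup>+x. ennreal (supnorm (rm m x) powr p) \<partial>Pm) \<le> ennreal (Rbound p powr p)"
proof (induction m)
  case 0
  have "supnorm (\<lambda>t. 0) = 0"
    using supnorm_le[of "\<lambda>t. 0" 0] supnorm_nonneg[OF bcadlag_zero] by simp
  then show ?case by simp
next
  case (Suc m)
  define k where "k = kp p"
  define q where "q = (\<integral>x. \<bar>ql x\<bar> powr p \<partial>Pm)"
  define s where "s = 2 powr (- 1 / p) * k * q powr (1 / p)"
  define A where "A = Rbound p"
  have k: "0 \<le> k" "k < 1" "k powr p = 2 / (p + 1)"
    using p by (simp_all add: k_def kp_nonneg kp_less_1 kp_powr)
  have q: "q \<ge> 0" by (simp add: q_def)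
  have s: "s \<ge> 0" using k by (simp add: s_def)
  have A: "A \<ge> 0" using Rbound_nonneg[OF p] by (simp add: A_def)
  have A_eq: "k * A + (8 + s) = A"
    using k by (simp add: A_def Rbound_def k_def s_def q_def field_simps)
  \<comment> \<open>So s is the L_p norm of the product of the root label with the independent
    variable \<open>ql\<close> of the left subtree; the factor 2 powr (- 1 / p) undoes the 2 in
    \<open>kp\<close>.\<close>
  have sp: "s powr p = 1 / (p + 1) * q"
  proof -
    have "s powr p = (2 powr (- 1 / p)) powr p * k powr p * (q powr (1 / p)) powr p"
      unfolding s_def by (simp only: powr_mult)
    also have "(2 powr (- 1 / p)) powr p = 1 / 2"
      unfolding powr_powr using p by (simp add: powr_minus)
    also have "(q powr (1 / p)) powr p = q"
      unfolding powr_powr using p q by simp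
    finally show ?thesis by (simp add: k)
  qed
  let ?H = "\<lambda>x. supnorm (rm m x)"
  let ?f1 = "\<lambda>x. max (\<bar>x []\<bar> * ?H (Vshift [1] x)) (\<bar>1 - x []\<bar> * ?H (Vshift [2] x))"
  let ?f2 = "\<lambda>x. \<bar>x []\<bar> * \<bar>ql (Vshift [1] x)\<bar>"
  have ms [measurable]: "Vshift [1] \<in> measurable Pm Pm" "Vshift [2] \<in> measurable Pm Pm"
    by (intro measurable_Vshift; simp)+
  have H0: "0 \<le> ?H x" for x by (intro supnorm_nonneg bcadlag_Rm)
  have i1: "(\<integral>\<^sup>+x. ennreal (?f1 x powr p) \<partial>Pm) \<le> ennreal ((k * A) powr p)"
  proof -
    have "(\<integral>\<^sup>+x. ennreal (?f1 x powr p) \<partial>Pm) \<le> ennreal (2 / (p + 1)) * (\<integral>\<^sup>+x. ennreal (?H x powr p) \<partial>Pm)"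
      using p H0 by (intro nn_integral_max_branches_le) auto
    also have "\<dots> \<le> ennreal (2 / (p + 1)) * ennreal (A powr p)"
      using Suc by (intro mult_left_mono) (auto simp: A_def)
    also have "\<dots> = ennreal ((k * A) powr p)"
      using k A p by (simp add: powr_mult flip: ennreal_mult)
    finally show ?thesis .
  qed
  have i2: "(\<integral>\<^sup>+x. ennreal (?f2 x powr p) \<partial>Pm) \<le> ennreal (s powr p)"
  proof -
    have "(\<integral>\<^sup>+x. ennreal (?f2 x powr p) \<partial>Pm) = (\<integral>\<^sup>+x. ennreal (\<bar>x []\<bar> powr p) * ennreal (\<bar>ql (Vshift [1] x)\<bar> powr p) \<partial>Pm)"
      by (simp add: powr_mult ennreal_mult)
    also have "\<dots> = ennreal (1 / (p + 1)) * (\<integral>\<^sup>+x. ennreal (\<bar>ql x\<bar> powr p) \<partial>Pm)"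
      using p nn_integral_root_times_shift[of "\<lambda>u. ennreal (\<bar>u\<bar> powr p)" "\<lambda>x. ennreal (\<bar>ql x\<bar> powr p)" 1]
      by (simp add: nn_integral_unif_powr)
    also have "(\<integral>\<^sup>+x. ennreal (\<bar>ql x\<bar> powr p) \<partial>Pm) = ennreal q"
      unfolding q_def using p by (intro nn_integral_eq_integral integrable_ql_powr) auto
    also have "ennreal (1 / (p + 1)) * ennreal q = ennreal (s powr p)"
      unfolding sp using p q by (simp flip: ennreal_mult)
    finally show ?thesis by simp
  qed
  have i3: "(\<integral>\<^sup>+x. ennreal (8 powr p) \<partial>Pm) \<le> ennreal (8 powr p)"
    by (simp add: Pm.emeasure_space_1)
  have "(\<integral>\<^sup>+x. ennreal (supnorm (rm (Suc m) x) powr p) \<partial>Pm) \<le> (\<integral>\<^sup>+x. ennreal ((?f1 x + (8 + ?f2 x)) powr p) \<partial>Pm)"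
  proof (rule nn_integral_mono_AE, use AE_generic_tree in eventually_elim)
    case (elim x)
    then show ?case
      using p by (intro ennreal_leI powr_mono2 supnorm_rm_Suc_le supnorm_nonneg bcadlag_Rm) auto
  qed
  also have "\<dots> \<le> ennreal ((k * A + (8 + s)) powr p)"
  proof (rule nn_integral_powr_add_le[OF _ _ _ _ _ _ _ i1])
    show "(\<integral>\<^sup>+x. ennreal ((8 + ?f2 x) powr p) \<partial>Pm) \<le> ennreal ((8 + s) powr p)"
      using p s by (intro nn_integral_powr_add_le[OF _ _ _ _ _ _ _ i3 i2]) auto
  qed (use p k A s H0 in \<open>auto simp: max_def\<close>)
  finally show ?case unfolding A_eq unfolding A_def .
qed

subsection \<open>Uniform convergence\<close>

definition rd :: "nat \<Rightarrow> (nat list \<Rightarrow> real) \<Rightarrow> real \<Rightarrow> real" where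
  "rd m x t = rm (Suc m) x t - rm m x t"

lemma bcadlag_rd: "bcadlag (rd m x)"
  unfolding rd_def[abs_def] by (intro bcadlag_diff bcadlag_Rm)

lemma measurable_supnorm_rd [measurable]: "(\<lambda>x. supnorm (rd m x)) \<in> borel_measurable Pm"
  by (intro measurable_supnorm bcadlag_rd) (simp add: rd_def)

text \<open>The root toll is the same at both levels because it uses \<open>ql\<close> and not
  \<open>qm m\<close>; hence it drops out.\<close>

lemma rd_Suc: "rd (Suc m) x t = T1 (x []) (rd m (Vshift [1] x)) t + T2 (x []) (rd m (Vshift [2] x)) t"
  unfolding rd_def by (subst (1 2) rm_Suc) (simp add: T1_def T2_def rd_def right_diff_distrib)

lemma supnorm_rd_Suc_le:
  assumes "generic_tree x"
  shows "supnorm (rd (Suc m) x) \<le>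
    max (\<bar>x []\<bar> * supnorm (rd m (Vshift [1] x))) (\<bar>1 - x []\<bar> * supnorm (rd m (Vshift [2] x)))"
  using supnorm_step_le[OF bcadlag_rd bcadlag_rd, of "x []" "\<lambda>t. 0" 0 m "Vshift [1] x" m "Vshift [2] x"]
    generic_tree_Nil[OF assms]
  unfolding rd_Suc[abs_def] by simp

text \<open>Here 2/3 is \<open>kp 2 powr 2\<close>. A maximum has no cross term, so in contrast to
  \<open>integral_qd_square\<close> no centring is involved. The induction starts from
  \<open>rd 0 = rm 1\<close>.\<close>

lemma nn_integral_supnorm_rd_le:
  "(\<integral>\<^sup>+x. ennreal ((supnorm (rd m x))\<^sup>2) \<partial>Pm) \<le> ennreal (Rbound 2 powr 2 * (2/3) ^ m)"
proof (induction m)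
  case 0
  have "rd 0 = rm 1" by (simp add: rd_def fun_eq_iff)
  then show ?case
    using nn_integral_supnorm_rm_le[of 2 1] by (simp add: supnorm_nonneg bcadlag_Rm)
next
  case (Suc m)
  let ?H = "\<lambda>x. supnorm (rd m x)"
  have H0: "0 \<le> ?H x" for x by (intro supnorm_nonneg bcadlag_rd)
  have "(\<integral>\<^sup>+x. ennreal ((supnorm (rd (Suc m) x))\<^sup>2) \<partial>Pm)
    \<le> (\<integral>\<^sup>+x. ennreal (max (\<bar>x []\<bar> * ?H (Vshift [1] x)) (\<bar>1 - x []\<bar> * ?H (Vshift [2] x)) powr 2) \<partial>Pm)"
  proof (rule nn_integral_mono_AE, use AE_generic_tree in eventually_elim)
    case (elim x)
    have "supnorm (rd (Suc m) x) powr 2 \<le> max (\<bar>x []\<bar> * ?H (Vshift [1] x)) (\<bar>1 - x []\<bar> * ?H (Vshift [2] x)) powr 2"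
      by (intro powr_mono2 supnorm_rd_Suc_le elim supnorm_nonneg bcadlag_rd) simp
    then show ?case
      by (intro ennreal_leI) (simp add: supnorm_nonneg bcadlag_rd)
  qed
  also have "\<dots> \<le> ennreal (2 / (2 + 1)) * (\<integral>\<^sup>+x. ennreal (?H x powr 2) \<partial>Pm)"
    using H0 by (intro nn_integral_max_branches_le) auto
  also have "\<dots> \<le> ennreal (2 / (2 + 1)) * ennreal (Rbound 2 powr 2 * (2/3) ^ m)"
    using Suc H0 by (intro mult_left_mono) auto
  also have "\<dots> = ennreal (Rbound 2 powr 2 * (2/3) ^ Suc m)"
    by (simp add: mult.left_commute flip: ennreal_mult)
  finally show ?case .
qed

text \<open>Weierstrass' criterion with the summable norms of the increments. The limit is given as
  a pointwise \<open>lim\<close> rather than as a series so that it is visibly measurable and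
  defined at every sample point.\<close>

lemma AE_rm_uniform_limit:
  "AE x in Pm. uniform_limit {0..1} (\<lambda>m. rm m x) (\<lambda>t. lim (\<lambda>m. rm m x t)) sequentially"
proof -
  have "AE x in Pm. summable (\<lambda>m. supnorm (rd m x))"
    by (rule Pm.AE_summable_of_L2_geometric[OF _ _ nn_integral_supnorm_rd_le])
      (auto intro: supnorm_nonneg bcadlag_rd)
  then show ?thesis
  proof eventually_elim
    case (elim x)
    have "uniform_limit {0..1} (\<lambda>m t. \<Sum>k<m. rd k x t) (\<lambda>t. suminf (\<lambda>k. rd k x t)) sequentially"
      using elim by (rule Weierstrass_m_test[rotated]) (auto intro: abs_le_supnorm bcadlag_rd)
    moreover have "(\<lambda>m t. \<Sum>k<m. rd k x t) = (\<lambda>m. rm m x)"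
      unfolding rd_def by (intro ext, subst sum_lessThan_telescope) simp
    ultimately have l: "uniform_limit {0..1} (\<lambda>m. rm m x) (\<lambda>t. suminf (\<lambda>k. rd k x t)) sequentially"
      by simp
    have "lim (\<lambda>m. rm m x t) = suminf (\<lambda>k. rd k x t)" if "t \<in> {0..1}" for t
      using tendsto_uniform_limitI[OF l that] by (rule limI)
    then show ?case
      using l by (subst uniform_limit_cong'[of _ _ _ _ "\<lambda>t. suminf (\<lambda>k. rd k x t)"]) auto
  qed
qed

section \<open>Transfer to the given probability space\<close>

theorem mainTheorem3:
  fixes M :: "'a measure" and U :: "nat list \<Rightarrow> 'a \<Rightarrow> real"
  assumes "prob_space M"
    and "prob_space.indep_vars M (\<lambda>_. borel) U Vset"
    and "\<forall>v\<in>Vset. distributed M lborel (U v) (indicator {0..1})"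
  shows "\<exists>R :: nat list \<Rightarrow> 'a \<Rightarrow> real \<Rightarrow> real.
     (\<forall>v\<in>Vset.
        (AE \<omega> in M. uniform_limit {0..1} (\<lambda>m. Rm U v m \<omega>) (R v \<omega>) sequentially) \<and>
        (AE \<omega> in M. cadlag01 (R v \<omega>)) \<and>
        (\<forall>t\<in>{0..1}. (\<lambda>\<omega>. R v \<omega> t) \<in> borel_measurable M) \<and>
        integrable M (\<lambda>\<omega>. (supnorm (R v \<omega>))\<^sup>2)) \<and>
     (\<forall>v\<in>Vset. AE \<omega> in M. \<forall>t\<in>{0..1}.
        R v \<omega> t = T1 (U v \<omega>) (R (v @ [1]) \<omega>) t + T2 (U v \<omega>) (R (v @ [2]) \<omega>) t
                   + Cfun U v \<omega> t) \<and>
     (\<forall>p::real. p > 1 \<longrightarrow> (\<forall>v\<in>Vset. \<forall>m::nat.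
        integrable M (\<lambda>\<omega>. supnorm (Rm U v m \<omega>) powr p) \<and>
        (\<integral>\<omega>. supnorm (Rm U v m \<omega>) powr p \<partial>M) powr (1 / p)
          \<le> (8 + 2 powr (- 1 / p) * kp p * (\<integral>\<omega>. \<bar>Qlim U [] \<omega>\<bar> powr p \<partial>M) powr (1 / p))
             / (1 - kp p)))"
proof -
  interpret prob_space M by fact
  define S where "S v \<omega> = Vshift v (\<lambda>w. U w \<omega>)" for v \<omega>
  have S [measurable]: "S v \<in> measurable M Pm" and S_distr: "distr M Pm (S v) = Pm" if "v \<in> Vset" for v
    using distr_family[OF assms(1,2) _ that] assms(3) by (auto simp: S_def[abs_def])
  have Rm_S: "Rm U v m \<omega> = rm m (S v \<omega>)" and Q_S: "Qlim U v \<omega> = ql (S v \<omega>)" for v m \<omega>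
    unfolding S_def by (rule Rm_Vshift Qlim_Vshift)+
  have Rm_meas [measurable]: "(\<lambda>\<omega>. Rm U v m \<omega> t) \<in> borel_measurable M" if "v \<in> Vset" for v m t
    unfolding Rm_S using that by measurable
  have Rm_nn: "(\<integral>\<^sup>+\<omega>. ennreal (supnorm (Rm U v m \<omega>) powr p) \<partial>M) \<le> ennreal (Rbound p powr p)"
    if v: "v \<in> Vset" and p: "p > 1" for v m p
  proof -
    have "(\<integral>\<^sup>+\<omega>. ennreal (supnorm (rm m (S v \<omega>)) powr p) \<partial>M) = (\<integral>\<^sup>+x. ennreal (supnorm (rm m x) powr p) \<partial>distr M Pm (S v))"
      using v by (subst nn_integral_distr) auto
    then show ?thesis using nn_integral_supnorm_rm_le[OF p] by (simp add: Rm_S S_distr[OF v])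
  qed
  have Rbound_eq: "Rbound p = (8 + 2 powr (- 1 / p) * kp p * (\<integral>\<omega>. \<bar>Qlim U [] \<omega>\<bar> powr p \<partial>M) powr (1 / p)) / (1 - kp p)" for p
  proof -
    have "(\<integral>x. \<bar>ql x\<bar> powr p \<partial>distr M Pm (S [])) = (\<integral>\<omega>. \<bar>ql (S [] \<omega>)\<bar> powr p \<partial>M)"
      by (intro integral_distr) auto
    then show ?thesis by (simp add: Rbound_def Q_S S_distr)
  qed
  define L where "L v \<omega> t = lim (\<lambda>m. Rm U v m \<omega> t)" for v \<omega> t
  have AE_L: "AE \<omega> in M. uniform_limit {0..1} (\<lambda>m. Rm U v m \<omega>) (L v \<omega>) sequentially" if v: "v \<in> Vset" for v
  proof -
    have "AE x in distr M Pm (S v). uniform_limit {0..1} (\<lambda>m. rm m x) (\<lambda>t. lim (\<lambda>m. rm m x t)) sequentially"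
      unfolding S_distr[OF v] by (rule AE_rm_uniform_limit)
    from AE_distrD[OF S[OF v] this] show ?thesis by (simp add: Rm_S L_def[abs_def])
  qed
  \<comment> \<open>The set of uniform convergence is not known to be measurable; the complement of
    a measurable null set that covers the exceptions takes its place.\<close>
  have "\<exists>G\<in>sets M. (AE \<omega> in M. \<omega> \<in> G) \<and> (\<forall>\<omega>\<in>G. uniform_limit {0..1} (\<lambda>m. Rm U v m \<omega>) (L v \<omega>) sequentially)"
    if v: "v \<in> Vset" for v
  proof -
    obtain N where N: "{\<omega>\<in>space M. \<not> uniform_limit {0..1} (\<lambda>m. Rm U v m \<omega>) (L v \<omega>) sequentially} \<subseteq> N"
      "emeasure M N = 0" "N \<in> sets M"
      using AE_E[OF AE_L[OF v]] .
    show ?thesis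
    proof (intro bexI conjI ballI)
      show "AE \<omega> in M. \<omega> \<in> space M - N"
        using N by (intro AE_I'[of N]) auto
    qed (use N in auto)
  qed
  then obtain G where G [measurable]: "\<And>v. v \<in> Vset \<Longrightarrow> G v \<in> sets M" and AE_G: "\<And>v. v \<in> Vset \<Longrightarrow> AE \<omega> in M. \<omega> \<in> G v"
    and G_lim: "\<And>v \<omega>. v \<in> Vset \<Longrightarrow> \<omega> \<in> G v \<Longrightarrow> uniform_limit {0..1} (\<lambda>m. Rm U v m \<omega>) (L v \<omega>) sequentially"
    by metis
  text \<open>Setting \<open>R\<close> to zero off the measurable set of convergence keeps its supremum norm measurable.\<close>
  define R where "R v \<omega> t = (if \<omega> \<in> G v then L v \<omega> t else 0)" for v \<omega> t
  have R_G: "R v \<omega> = L v \<omega>" if "\<omega> \<in> G v" for v \<omega>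
    using that by (simp add: R_def fun_eq_iff)
  have R_lim: "uniform_limit {0..1} (\<lambda>m. Rm U v m \<omega>) (R v \<omega>) sequentially" if "v \<in> Vset" "\<omega> \<in> G v" for v \<omega>
    using G_lim[OF that] R_G[OF that(2)] by simp
  have R_bcadlag: "bcadlag (R v \<omega>)" if "v \<in> Vset" for v \<omega>
  proof (cases "\<omega> \<in> G v")
    case True
    show ?thesis by (rule bcadlag_uniform_limit[OF bcadlag_Rm R_lim[OF that True]])
  next
    case False
    then show ?thesis by (simp add: R_def[abs_def])
  qed
  have R_meas: "(\<lambda>\<omega>. R v \<omega> t) \<in> borel_measurable M" if v: "v \<in> Vset" for v t
    unfolding R_def L_def using v by measurable
  have R_sup_meas [measurable]: "(\<lambda>\<omega>. supnorm (R v \<omega>)) \<in> borel_measurable M" if v: "v \<in> Vset" for v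
    by (intro measurable_supnorm R_bcadlag R_meas v)
  have R_sq: "integrable M (\<lambda>\<omega>. (supnorm (R v \<omega>))\<^sup>2)" if v: "v \<in> Vset" for v
  proof (rule integrableI_bounded)
    \<comment> \<open>Preparation for Fatou: the norms converge under uniform convergence, and the
      bound for p = 2 does not depend on m.\<close>
    have "(\<integral>\<^sup>+\<omega>. ennreal (norm ((supnorm (R v \<omega>))\<^sup>2)) \<partial>M) = (\<integral>\<^sup>+\<omega>. liminf (\<lambda>m. ennreal ((supnorm (Rm U v m \<omega>))\<^sup>2)) \<partial>M)"
    proof (rule nn_integral_cong_AE, use AE_G[OF v] in eventually_elim)
      case (elim \<omega>)
      have "(\<lambda>m. supnorm (Rm U v m \<omega>)) \<longlonglongrightarrow> supnorm (R v \<omega>)"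
        by (rule tendsto_supnorm[OF bcadlag_Rm R_bcadlag[OF v] R_lim[OF v elim]])
      then have "(\<lambda>m. ennreal ((supnorm (Rm U v m \<omega>))\<^sup>2)) \<longlonglongrightarrow> ennreal ((supnorm (R v \<omega>))\<^sup>2)"
        by (intro tendsto_intros)
      then have "ennreal ((supnorm (R v \<omega>))\<^sup>2) = liminf (\<lambda>m. ennreal ((supnorm (Rm U v m \<omega>))\<^sup>2))"
        by (rule lim_imp_Liminf[OF sequentially_bot, symmetric])
      then show ?case by simp
    qed
    also have "\<dots> \<le> liminf (\<lambda>m. \<integral>\<^sup>+\<omega>. ennreal ((supnorm (Rm U v m \<omega>))\<^sup>2) \<partial>M)"
      unfolding Rm_S using v by (intro nn_integral_liminf) measurable
    also have "\<dots> \<le> liminf (\<lambda>m. ennreal (Rbound 2 powr 2))"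
      using Rm_nn[OF v, of 2] by (intro Liminf_mono always_eventually) (simp add: supnorm_nonneg bcadlag_Rm)
    also have "\<dots> < \<infinity>" by (simp add: Liminf_const)
    finally show "(\<integral>\<^sup>+\<omega>. ennreal (norm ((supnorm (R v \<omega>))\<^sup>2)) \<partial>M) < \<infinity>" .
  qed (use v in measurable)
  have R_fix: "AE \<omega> in M. \<forall>t\<in>{0..1}. R v \<omega> t = T1 (U v \<omega>) (R (v @ [1]) \<omega>) t + T2 (U v \<omega>) (R (v @ [2]) \<omega>) t + Cfun U v \<omega> t"
    if v: "v \<in> Vset" for v
  proof -
    have v12: "v @ [1] \<in> Vset" "v @ [2] \<in> Vset" using v by auto
    show ?thesis
      using AE_G[OF v] AE_G[OF v12(1)] AE_G[OF v12(2)]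
    proof eventually_elim
      case (elim \<omega>)
      show ?case
      proof
        fix t :: real assume t: "t \<in> {0..1}"
        \<comment> \<open>For fixed t, pointwise convergence of the subtrees at the rescaled times
          is enough; these times stay in [0,1], where the limit is controlled.\<close>
        note lim1 = tendsto_uniform_limitI[OF R_lim[OF v12(1) elim(2)]]
        note lim2 = tendsto_uniform_limitI[OF R_lim[OF v12(2) elim(3)]]
        have "(\<lambda>m. T1 (U v \<omega>) (Rm U (v @ [1]) m \<omega>) t) \<longlonglongrightarrow> T1 (U v \<omega>) (R (v @ [1]) \<omega>) t"
          using t unfolding T1_def by (auto intro!: tendsto_mult_left lim1 simp del: One_nat_def)
        moreover have "(\<lambda>m. T2 (U v \<omega>) (Rm U (v @ [2]) m \<omega>) t) \<longlonglongrightarrow> T2 (U v \<omega>) (R (v @ [2]) \<omega>) t"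
          using t T2_argument[of t "U v \<omega>"] unfolding T2_def by (auto intro!: tendsto_mult_left lim2)
        ultimately have "(\<lambda>m. Rm U v (Suc m) \<omega> t) \<longlonglongrightarrow>
            T1 (U v \<omega>) (R (v @ [1]) \<omega>) t + T2 (U v \<omega>) (R (v @ [2]) \<omega>) t + Cfun U v \<omega> t"
          unfolding Rm_Suc by (intro tendsto_add tendsto_const)
        moreover have "(\<lambda>m. Rm U v (Suc m) \<omega> t) \<longlonglongrightarrow> R v \<omega> t"
          by (rule LIMSEQ_Suc[OF tendsto_uniform_limitI[OF R_lim[OF v elim(1)] t]])
        ultimately show "R v \<omega> t = T1 (U v \<omega>) (R (v @ [1]) \<omega>) t + T2 (U v \<omega>) (R (v @ [2]) \<omega>) t + Cfun U v \<omega> t"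
          using LIMSEQ_unique by blast
      qed
    qed
  qed
  have moment: "integrable M (\<lambda>\<omega>. supnorm (Rm U v m \<omega>) powr p)"
    "(\<integral>\<omega>. supnorm (Rm U v m \<omega>) powr p \<partial>M) powr (1 / p) \<le> Rbound p"
    if v: "v \<in> Vset" and p: "p > 1" for v m p
  proof -
    have m: "(\<lambda>\<omega>. supnorm (Rm U v m \<omega>) powr p) \<in> borel_measurable M"
      unfolding Rm_S using v by measurable
    show int: "integrable M (\<lambda>\<omega>. supnorm (Rm U v m \<omega>) powr p)"
      using le_less_trans[OF Rm_nn[OF v p, of m] ennreal_less_top] by (intro integrableI_bounded m) simp
    have "ennreal (\<integral>\<omega>. supnorm (Rm U v m \<omega>) powr p \<partial>M) \<le> ennreal (Rbound p powr p)"
      using Rm_nn[OF v p, of m] by (subst (asm) nn_integral_eq_integral[OF int]) auto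
    then have "(\<integral>\<omega>. supnorm (Rm U v m \<omega>) powr p \<partial>M) \<le> Rbound p powr p"
      by (simp add: ennreal_le_iff)
    then have "(\<integral>\<omega>. supnorm (Rm U v m \<omega>) powr p \<partial>M) powr (1 / p) \<le> (Rbound p powr p) powr (1 / p)"
      using p by (intro powr_mono2) auto
    also have "\<dots> = Rbound p"
      using p Rbound_nonneg[OF p] by (simp add: powr_powr)
    finally show "(\<integral>\<omega>. supnorm (Rm U v m \<omega>) powr p \<partial>M) powr (1 / p) \<le> Rbound p" .
  qed
  have R_unif: "AE \<omega> in M. uniform_limit {0..1} (\<lambda>m. Rm U v m \<omega>) (R v \<omega>) sequentially" if v: "v \<in> Vset" for v
    using AE_G[OF v] by eventually_elim (rule R_lim[OF v])
  have R_cadlag: "cadlag01 (R v \<omega>)" if "v \<in> Vset" for v \<omega>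
    using R_bcadlag[OF that] by (simp add: bcadlag_def)
  show ?thesis
    unfolding Rbound_eq[symmetric]
    by (intro exI[of _ R] conjI ballI allI impI)
      (simp_all only: R_unif R_cadlag R_meas R_sq R_fix moment eventually_True simp_thms)
qed

end
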